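(* For each orthogonal, left-finite TRS, if $s$ strongly $p$-converges to $t$, then there is a reduction of length at most $\omega$ from $s$ strongly $p$-converging to $t$.
   Context: Orthogonal = left-linear and non-overlapping; left-finite = all left-hand sides finite. Partial terms over $\Sigma_\bot=\Sigma\uplus\{\bot\}$ with $s\le_\bot t$ iff $s$ is $t$ with some subterms replaced by $\bot$ form a complete semilattice; $\liminf_{\iota\to\alpha}a_\iota=\bigvee_{\beta<\alpha}\bigwedge_{\beta\le\iota<\alpha}a_\iota$. A reduction $(t_\iota\to_{\pi_\iota}t_{\iota+1})_{\iota<\alpha}$ with contexts $c_\iota$ ($t_\iota$ with position $\pi_\iota$ replaced by $\bot$) strongly $p$-converges to $t$ if $\liminf_{\iota\to\lambda}c_\iota=t_\lambda$ for every limit $\lambda<\alpha$, and $t$ is the last term (closed) or $t=\liminf_{\iota\to\alpha}c_\iota$ (open). *)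

theory Defs
  imports Main "HOL-Library.Extended_Nat"
begin

text \<open>Symbols of Sigma_bot together with variables. The signature is the type 'f
  with arity function ar.\<close>
datatype ('f, 'v) sym = Fun 'f | Var 'v | Bot

type_synonym pos = "nat list"

text \<open>A (possibly infinite, possibly partial) term is a labelled tree, given as a
  partial map from positions to symbols.\<close>
type_synonym ('f, 'v) pterm = "pos \<Rightarrow> ('f, 'v) sym option"

definition wf_term :: "('f \<Rightarrow> nat) \<Rightarrow> ('f, 'v) pterm \<Rightarrow> bool" where
  "wf_term ar t \<longleftrightarrow> t [] \<noteq> None \<and>
     (\<forall>p i. t (p @ [i]) \<noteq> None \<longrightarrow> t p \<noteq> None) \<and>
     (\<forall>p. t p \<noteq> None \<longrightarrow>
        (\<forall>i. t (p @ [i]) \<noteq> None \<longleftrightarrow> (\<exists>f. t p = Some (Fun f) \<and> i < ar f)))"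

definition total_term :: "('f \<Rightarrow> nat) \<Rightarrow> ('f, 'v) pterm \<Rightarrow> bool" where
  "total_term ar t \<longleftrightarrow> wf_term ar t \<and> (\<forall>p. t p \<noteq> Some Bot)"

definition finite_term :: "('f, 'v) pterm \<Rightarrow> bool" where
  "finite_term t \<longleftrightarrow> finite {p. t p \<noteq> None}"

definition vars :: "('f, 'v) pterm \<Rightarrow> 'v set" where
  "vars t = {x. \<exists>p. t p = Some (Var x)}"

definition subterm :: "('f, 'v) pterm \<Rightarrow> pos \<Rightarrow> ('f, 'v) pterm" where
  "subterm t p = (\<lambda>q. t (p @ q))"

definition replace :: "('f, 'v) pterm \<Rightarrow> pos \<Rightarrow> ('f, 'v) pterm \<Rightarrow> ('f, 'v) pterm" where
  "replace t p u = (\<lambda>q. if take (length p) q = p then u (drop (length p) q) else t q)"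

definition bot_term :: "('f, 'v) pterm" where
  "bot_term = (\<lambda>q. if q = [] then Some Bot else None)"

text \<open>Application of a substitution (variables are leaves, so the variable prefix of a
  position is unique).\<close>
definition subst :: "('v \<Rightarrow> ('f, 'v) pterm) \<Rightarrow> ('f, 'v) pterm \<Rightarrow> ('f, 'v) pterm" where
  "subst \<sigma> l = (\<lambda>q.
     if \<exists>q1 q2 x. q = q1 @ q2 \<and> l q1 = Some (Var x)
     then (let (q1, x) = (SOME (q1, x). take (length q1) q = q1 \<and> l q1 = Some (Var x))
           in \<sigma> x (drop (length q1) q))
     else l q)"

type_synonym ('f, 'v) rule = "('f, 'v) pterm \<times> ('f, 'v) pterm"

definition is_TRS :: "('f \<Rightarrow> nat) \<Rightarrow> ('f, 'v) rule set \<Rightarrow> bool" where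
  "is_TRS ar R \<longleftrightarrow> (\<forall>(l, r) \<in> R. total_term ar l \<and> total_term ar r \<and>
      (\<forall>x. l [] \<noteq> Some (Var x)) \<and> vars r \<subseteq> vars l)"

definition linear_term :: "('f, 'v) pterm \<Rightarrow> bool" where
  "linear_term t \<longleftrightarrow> (\<forall>p q x. t p = Some (Var x) \<and> t q = Some (Var x) \<longrightarrow> p = q)"

definition left_linear :: "('f, 'v) rule set \<Rightarrow> bool" where
  "left_linear R \<longleftrightarrow> (\<forall>(l, r) \<in> R. linear_term l)"

text \<open>Two rules overlap if a non-variable subterm of the lhs of the first unifies with
  the lhs of the second (rules renamed apart, hence two substitutions), unless this is
  the root position and the rules are the same rule.\<close>
definition non_overlapping :: "('f \<Rightarrow> nat) \<Rightarrow> ('f, 'v) rule set \<Rightarrow> bool" where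
  "non_overlapping ar R \<longleftrightarrow>
     (\<forall>\<rho>1 \<in> R. \<forall>\<rho>2 \<in> R. \<forall>p.
        (\<exists>f. fst \<rho>1 p = Some (Fun f)) \<and>
        (\<exists>\<sigma>1 \<sigma>2. (\<forall>x. wf_term ar (\<sigma>1 x)) \<and> (\<forall>x. wf_term ar (\<sigma>2 x)) \<and>
                  subst \<sigma>1 (subterm (fst \<rho>1) p) = subst \<sigma>2 (fst \<rho>2))
        \<longrightarrow> p = [] \<and> \<rho>1 = \<rho>2)"

definition orthogonal :: "('f \<Rightarrow> nat) \<Rightarrow> ('f, 'v) rule set \<Rightarrow> bool" where
  "orthogonal ar R \<longleftrightarrow> left_linear R \<and> non_overlapping ar R"

definition left_finite :: "('f, 'v) rule set \<Rightarrow> bool" where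
  "left_finite R \<longleftrightarrow> (\<forall>(l, r) \<in> R. finite_term l)"

definition rstep :: "('f, 'v) rule set \<Rightarrow> ('f, 'v) pterm \<Rightarrow> pos \<Rightarrow> ('f, 'v) pterm \<Rightarrow> bool" where
  "rstep R t p u \<longleftrightarrow> t p \<noteq> None \<and>
     (\<exists>(l, r) \<in> R. \<exists>\<sigma>. subterm t p = subst \<sigma> l \<and> u = replace t p (subst \<sigma> r))"

definition le_bot :: "('f, 'v) pterm \<Rightarrow> ('f, 'v) pterm \<Rightarrow> bool" where
  "le_bot s t \<longleftrightarrow> (\<forall>p. s p \<noteq> None \<longrightarrow> t p \<noteq> None \<and> (s p = Some Bot \<or> s p = t p))"

definition is_glb :: "('f \<Rightarrow> nat) \<Rightarrow> ('f, 'v) pterm set \<Rightarrow> ('f, 'v) pterm \<Rightarrow> bool" where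
  "is_glb ar S g \<longleftrightarrow> wf_term ar g \<and> (\<forall>s\<in>S. le_bot g s) \<and>
     (\<forall>h. wf_term ar h \<and> (\<forall>s\<in>S. le_bot h s) \<longrightarrow> le_bot h g)"

definition is_lub :: "('f \<Rightarrow> nat) \<Rightarrow> ('f, 'v) pterm set \<Rightarrow> ('f, 'v) pterm \<Rightarrow> bool" where
  "is_lub ar S g \<longleftrightarrow> wf_term ar g \<and> (\<forall>s\<in>S. le_bot s g) \<and>
     (\<forall>h. wf_term ar h \<and> (\<forall>s\<in>S. le_bot s h) \<longrightarrow> le_bot g h)"

text \<open>t = liminf_{iota -> lam} c_iota = lub_{beta<lam} glb_{beta<=iota<lam} c_iota
  (glbs of nonempty sets and lubs of directed sets exist and are unique in the
  complete semilattice of partial terms).\<close>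
definition is_liminf :: "('f \<Rightarrow> nat) \<Rightarrow> ('i::wellorder \<Rightarrow> ('f, 'v) pterm) \<Rightarrow> 'i \<Rightarrow> ('f, 'v) pterm \<Rightarrow> bool" where
  "is_liminf ar c lam t \<longleftrightarrow>
     (\<exists>g. (\<forall>\<beta><lam. is_glb ar {c \<iota> | \<iota>. \<beta> \<le> \<iota> \<and> \<iota> < lam} (g \<beta>)) \<and>
          is_lub ar (g ` {..<lam}) t)"

text \<open>Ordinals are represented by elements of a well-ordered type.\<close>
definition ord_zero :: "'i::wellorder" where
  "ord_zero = (LEAST i. True)"

definition ord_succ :: "'i::wellorder \<Rightarrow> 'i" where
  "ord_succ i = (LEAST j. i < j)"

definition is_limit :: "'i::wellorder \<Rightarrow> bool" where
  "is_limit lam \<longleftrightarrow> lam \<noteq> ord_zero \<and> (\<forall>i<lam. ord_succ i < lam)"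

definition strongly_p_converges ::
  "('f \<Rightarrow> nat) \<Rightarrow> ('f, 'v) rule set \<Rightarrow> ('f, 'v) pterm \<Rightarrow> ('f, 'v) pterm \<Rightarrow>
   'i::wellorder \<Rightarrow> ('i \<Rightarrow> ('f, 'v) pterm) \<Rightarrow> ('i \<Rightarrow> pos) \<Rightarrow> bool" where
  "strongly_p_converges ar R s t \<alpha> ts ps \<longleftrightarrow>
     (let c = (\<lambda>i. replace (ts i) (ps i) bot_term) in
       ts ord_zero = s \<and>
       (\<forall>i<\<alpha>. wf_term ar (ts i) \<and> rstep R (ts i) (ps i) (ts (ord_succ i))) \<and>
       (\<forall>lam<\<alpha>. is_limit lam \<longrightarrow> is_liminf ar c lam (ts lam)) \<and>
       (if is_limit \<alpha> then is_liminf ar c \<alpha> t else wf_term ar t \<and> t = ts \<alpha>))"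

end

theory Submission
  imports Defs "HOL-Library.Sublist"
begin

text \<open>
  Compression rests on a coinductive description of what a reduction of length at most omega
  can reach: \<open>conv s t\<close> holds if \<open>s\<close> reduces in finitely many steps to a term with the root
  symbol of \<open>t\<close> whose arguments are again related to those of \<open>t\<close>, or if \<open>t\<close> is bottom and \<open>s\<close> either
  reaches it finitely or admits infinitely many root contractions interleaved with finite reductions.
  This relation is closed under a further rewrite step of \<open>t\<close>, because a finite linear
  left-hand side only inspects a finite part of \<open>t\<close>, and it passes through limit ordinals by
  coinduction: a position of the limit either stabilises, or is bottom because it is contracted
  cofinally often. Conversely, a fair strategy that exposes \<open>t\<close> level by level and keeps
  contracting at the root-active positions turns \<open>conv s t\<close> into a reduction of length at
  most omega.
\<close>

section \<open>Partial terms\<close>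

text \<open>The given reduction is never permuted and no residuals are traced. A reduction of length
  omega is a poor invariant: a step appended to it would have to be moved in front of infinitely
  many others. The relation \<open>conv\<close> forgets how steps in different arguments are
  interleaved and keeps only that finitely many steps expose each proper label of \<open>t\<close>.
  An appended step then disturbs a finite part, and an interleaving is chosen once, at the end. The
  delicate point is bottom. Limits are taken over contexts, not over terms, so a position may carry
  the same label at all stages and still become bottom, because it is contracted cofinally often.
  Bottom must be witnessed by contractions, not by changing labels. Hence \<open>root_active\<close>
  counts root steps, lifted steps keep the root contraction visible, and the final strategy goes on
  contracting where nothing of \<open>t\<close> is left to expose. Across a limit the claim is made
  for every position above which nothing is contracted in the interval considered, since only there
  does the subterm have a continuous history.\<close>

lemma take_length_eq_iff_prefix: "take (length p) q = p \<longleftrightarrow> prefix p q"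
  by (metis append_eq_conv_conj prefix_def take_is_prefix)

lemma subterm_Nil [simp]: "subterm t [] = t"
  by (simp add: subterm_def)

lemma subterm_app [simp]: "subterm t p q = t (p @ q)"
  by (simp add: subterm_def)

lemma subterm_subterm [simp]: "subterm (subterm t p) q = subterm t (p @ q)"
  by (simp add: subterm_def)

lemma replace_append [simp]: "replace t p u (p @ q) = u q"
  by (simp add: replace_def)

lemma replace_same [simp]: "replace t p u p = u []"
  by (simp add: replace_def)

lemma replace_outside: "\<not> prefix p q \<Longrightarrow> replace t p u q = t q"
  by (simp add: replace_def take_length_eq_iff_prefix)

lemma subterm_replace_same [simp]: "subterm (replace t p u) p = u"
  by (simp add: fun_eq_iff)

lemma subterm_replace_parallel:
  "\<not> prefix p q \<Longrightarrow> \<not> prefix q p \<Longrightarrow> subterm (replace t q u) p = subterm t p"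
  by (rule ext, simp, rule replace_outside) (metis prefix_same_cases prefixI)

lemma replace_Nil [simp]: "replace t [] u = u"
  by (simp add: replace_def)

lemma replace_subterm_self [simp]: "replace t p (subterm t p) = t"
  by (rule ext) (simp add: replace_def, metis append_take_drop_id)

lemma replace_replace_same [simp]: "replace (replace t p u) p v = replace t p v"
  by (simp add: replace_def fun_eq_iff)

lemma replace_append_pos: "replace t (p @ q) v = replace t p (replace (subterm t p) q v)"
proof
  fix r
  show "replace t (p @ q) v r = replace t p (replace (subterm t p) q v) r"
  proof (cases "prefix p r")
    case True
    then show ?thesis by (auto simp: replace_def prefix_def)
  next
    case False
    then have "\<not> prefix (p @ q) r" by (metis append_prefixD)
    with False show ?thesis by (simp add: replace_outside)
  qed
qed

lemma bot_term_Nil [simp]: "bot_term [] = Some Bot"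
  by (simp add: bot_term_def)

lemma bot_term_not_Nil [simp]: "q \<noteq> [] \<Longrightarrow> bot_term q = None"
  by (simp add: bot_term_def)

lemma wf_term_Nil: "wf_term ar t \<Longrightarrow> t [] \<noteq> None"
  by (simp add: wf_term_def)

lemma wf_term_child_iff:
  "wf_term ar t \<Longrightarrow> t (p @ [i]) \<noteq> None \<longleftrightarrow> (\<exists>f. t p = Some (Fun f) \<and> i < ar f)"
  unfolding wf_term_def by (metis option.distinct(1))

lemma wf_term_prefix: "wf_term ar t \<Longrightarrow> t (p @ q) \<noteq> None \<Longrightarrow> t p \<noteq> None"
proof (induction q rule: rev_induct)
  case (snoc i q)
  then show ?case unfolding wf_term_def by (metis append.assoc)
qed simp

lemma wf_term_Fun:
  assumes "wf_term ar t" "t (p @ q) \<noteq> None" "q \<noteq> []"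
  shows "\<exists>f. t p = Some (Fun f)"
proof -
  obtain i r where "q = i # r" using assms(3) by (cases q) auto
  then have "t ((p @ [i]) @ r) \<noteq> None" using assms(2) by simp
  then have "t (p @ [i]) \<noteq> None" by (rule wf_term_prefix[OF assms(1)])
  then show ?thesis using wf_term_child_iff[OF assms(1)] by blast
qed

lemma wf_term_strict_prefix:
  "wf_term ar t \<Longrightarrow> t p \<noteq> None \<Longrightarrow> strict_prefix q p \<Longrightarrow> \<exists>f. t q = Some (Fun f)"
  by (auto simp: strict_prefix_def prefix_def dest: wf_term_Fun)

lemma wf_term_root_leaf:
  assumes "wf_term ar t" "\<not> (\<exists>f. t [] = Some (Fun f))" "q \<noteq> []"
  shows "t q = None"
  using wf_term_Fun[of ar t "[]" q] assms by (cases "t q") auto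

lemma wf_term_root_Bot: "wf_term ar t \<Longrightarrow> t [] = Some Bot \<Longrightarrow> t = bot_term"
  by (rule ext) (metis bot_term_Nil bot_term_not_Nil option.inject sym.distinct(3) wf_term_root_leaf)

lemma wf_bot_term [simp]: "wf_term ar bot_term"
  by (simp add: wf_term_def bot_term_def)

lemma wf_termI:
  assumes "t [] \<noteq> None"
    and "\<And>p i. t (p @ [i]) \<noteq> None \<longleftrightarrow> (\<exists>f. t p = Some (Fun f) \<and> i < ar f)"
  shows "wf_term ar t"
  unfolding wf_term_def using assms by (metis option.distinct(1))

lemma wf_subterm:
  assumes "wf_term ar t" "t p \<noteq> None"
  shows "wf_term ar (subterm t p)"
proof (rule wf_termI)
  fix q i
  show "subterm t p (q @ [i]) \<noteq> None \<longleftrightarrow> (\<exists>f. subterm t p q = Some (Fun f) \<and> i < ar f)"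
    using wf_term_child_iff[OF assms(1), of "p @ q" i] by simp
qed (use assms(2) in simp)

lemma wf_replace:
  assumes "wf_term ar t" "t p \<noteq> None" "wf_term ar u"
  shows "wf_term ar (replace t p u)"
proof (rule wf_termI)
  show "replace t p u [] \<noteq> None"
    using assms wf_term_Nil by (cases p) (auto simp: replace_def)
next
  fix q i
  consider r where "q = p @ r" | "p = q @ [i]" | "\<not> prefix p (q @ [i])" "\<not> prefix p q"
    by (metis prefix_def prefix_snoc)
  then show "replace t p u (q @ [i]) \<noteq> None
    \<longleftrightarrow> (\<exists>f. replace t p u q = Some (Fun f) \<and> i < ar f)"
  proof cases
    case 1
    then show ?thesis using wf_term_child_iff[OF assms(3)] by simp
  next
    case 2
    then have "replace t p u q = t q" by (simp add: replace_outside)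
    then show ?thesis
      using 2 assms(2) wf_term_child_iff[OF assms(1), of q i] wf_term_Nil[OF assms(3)] by simp
  next
    case 3
    then show ?thesis using wf_term_child_iff[OF assms(1)] by (simp add: replace_outside)
  qed
qed

text \<open>Finite branching is what allows finite reductions of all arguments to be concatenated
  into one finite reduction.\<close>

lemma wf_term_bounded_children:
  assumes "wf_term ar t"
  shows "\<exists>m. \<forall>i\<ge>m. t [i] = None"
proof (cases "\<exists>f. t [] = Some (Fun f)")
  case True
  then obtain f where f: "t [] = Some (Fun f)" ..
  have "t [i] = None" if "ar f \<le> i" for i
    using wf_term_child_iff[OF assms, of "[]" i] f that by (cases "t [i]") auto
  then show ?thesis by blast
next
  case False
  have "t [i] = None" for i by (rule wf_term_root_leaf[OF assms False]) simp
  then show ?thesis by blast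
qed

text \<open>Extra positions of \<open>u\<close> are impossible: a child exists exactly when the
  symbol above it has the arity, so the labels of \<open>t\<close> also determine where
  \<open>u\<close> ends.\<close>

lemma wf_term_eqI:
  assumes wf: "wf_term ar u" "wf_term ar t"
    and eq: "\<And>p a. t p = Some a \<Longrightarrow> u p = Some a"
  shows "u = t"
proof
  fix p
  show "u p = t p"
  proof (induction p rule: rev_induct)
    case Nil
    then show ?case using eq wf_term_Nil[OF wf(2)] by auto
  next
    case (snoc i p)
    then show ?case
      using eq[of "p @ [i]"] wf_term_child_iff[OF wf(1), of p i] wf_term_child_iff[OF wf(2), of p i]
      by (cases "t (p @ [i])") auto
  qed
qed

text \<open>Inclusion of the domains comes for free: going down from the root, a child in
  \<open>s\<close> sits under a function symbol that \<open>t\<close> shares, so \<open>t\<close>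
  has the child too. This is why \<open>eq\<close> may assume that \<open>t\<close> is defined at
  \<open>p\<close>.\<close>

lemma le_botI:
  assumes wf: "wf_term ar s" "wf_term ar t"
    and eq: "\<And>p a. s p = Some a \<Longrightarrow> a \<noteq> Bot \<Longrightarrow> t p \<noteq> None \<Longrightarrow> t p = Some a"
  shows "le_bot s t"
proof -
  have "t p \<noteq> None" if "s p \<noteq> None" for p
    using that
  proof (induction p rule: rev_induct)
    case Nil
    then show ?case using wf_term_Nil[OF wf(2)] by simp
  next
    case (snoc i p)
    then obtain f where "s p = Some (Fun f)" "i < ar f"
      using wf_term_child_iff[OF wf(1)] by blast
    with snoc.IH eq[of p "Fun f"] show ?case
      using wf_term_child_iff[OF wf(2)] by auto
  qed
  then show ?thesis
    unfolding le_bot_def using eq by (metis not_None_eq)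
qed

lemma le_bot_Some: "le_bot s t \<Longrightarrow> s p = Some a \<Longrightarrow> a \<noteq> Bot \<Longrightarrow> t p = Some a"
  unfolding le_bot_def by (metis option.distinct(1) option.inject)

lemma le_bot_antisym:
  assumes "le_bot s t" "le_bot t s"
  shows "s = t"
proof
  fix p
  show "s p = t p"
    using assms unfolding le_bot_def by metis
qed

section \<open>Limit inferior\<close>

definition agree :: "('f, 'v) pterm set \<Rightarrow> pos \<Rightarrow> bool" where
  "agree S p \<longleftrightarrow> (\<forall>s\<in>S. \<forall>s'\<in>S. s p = s' p)"

text \<open>The meet cuts every path at its highest disagreement. The member picked by
  \<open>SOME\<close> is consulted only where all members agree, so every choice gives the same
  term.\<close>

definition glb_term :: "('f, 'v) pterm set \<Rightarrow> ('f, 'v) pterm" where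
  "glb_term S p =
     (if \<forall>q. strict_prefix q p \<longrightarrow> agree S q
      then if agree S p then (SOME s. s \<in> S) p else Some Bot
      else None)"

lemma glb_term_Some_iff:
  assumes "s \<in> S" "a \<noteq> Bot"
  shows "glb_term S p = Some a \<longleftrightarrow> (\<forall>q. prefix q p \<longrightarrow> agree S q) \<and> s p = Some a"
proof -
  have "(SOME s. s \<in> S) \<in> S" using assms(1) by (rule someI[of "\<lambda>s. s \<in> S"])
  then have "agree S p \<Longrightarrow> (SOME s. s \<in> S) p = s p"
    using assms(1) by (auto simp: agree_def)
  moreover have "(\<forall>q. prefix q p \<longrightarrow> agree S q)
      \<longleftrightarrow> (\<forall>q. strict_prefix q p \<longrightarrow> agree S q) \<and> agree S p"
    by (metis prefix_order.le_less)
  ultimately show ?thesis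
    using assms(2) by (simp add: glb_term_def)
qed

lemma wf_glb_term:
  assumes S: "S \<noteq> {}" and wf: "\<And>s. s \<in> S \<Longrightarrow> wf_term ar s"
  shows "wf_term ar (glb_term S)"
proof (rule wf_termI)
  obtain s where s: "s \<in> S" using S by blast
  have some: "(SOME s. s \<in> S) \<in> S" using s by (rule someI[of "\<lambda>s. s \<in> S"])
  show "glb_term S [] \<noteq> None"
    using wf_term_Nil[OF wf[OF some]] by (simp add: glb_term_def)
  fix p :: pos and i
  have A: "\<And>q. strict_prefix q (p @ [i]) \<longleftrightarrow> prefix q p"
    using prefix_snoc by (auto simp: prefix_order.less_le)
  show "glb_term S (p @ [i]) \<noteq> None \<longleftrightarrow> (\<exists>f. glb_term S p = Some (Fun f) \<and> i < ar f)"
  proof (cases "\<forall>q. prefix q p \<longrightarrow> agree S q")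
    case True
    have *: "glb_term S (p @ [i]) \<noteq> None \<longleftrightarrow> s (p @ [i]) \<noteq> None"
    proof (cases "agree S (p @ [i])")
      case ag: True
      then have "(SOME s. s \<in> S) (p @ [i]) = s (p @ [i])"
        using s some by (auto simp: agree_def)
      then show ?thesis using True ag by (simp add: glb_term_def A)
    next
      \<comment> \<open>The members agree on the parent, and its symbol decides for all of them
        alike whether the child exists. Two different labels rule out absence, so a
        \<open>Bot\<close> is legitimate here.\<close>
      case False
      then obtain s1 s2 where s12: "s1 \<in> S" "s2 \<in> S" "s1 (p @ [i]) \<noteq> s2 (p @ [i])"
        by (auto simp: agree_def)
      have "agree S p" using True by simp
      then have "s1 p = s p" "s2 p = s p" using s12 s by (auto simp: agree_def)
      then have "s1 (p @ [i]) \<noteq> None \<longleftrightarrow> s (p @ [i]) \<noteq> None"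
        "s2 (p @ [i]) \<noteq> None \<longleftrightarrow> s (p @ [i]) \<noteq> None"
        by (simp_all only: wf_term_child_iff[OF wf] s s12(1,2))
      then have "s (p @ [i]) \<noteq> None" using s12(3) by force
      then show ?thesis using False True by (simp add: glb_term_def A)
    qed
    have **: "glb_term S p = Some (Fun f) \<longleftrightarrow> s p = Some (Fun f)" for f
      using glb_term_Some_iff[OF s, of "Fun f" p] True by simp
    show ?thesis
      unfolding * ** by (rule wf_term_child_iff[OF wf[OF s]])
  next
    case False
    then have "glb_term S (p @ [i]) = None"
      unfolding glb_term_def A by (rule if_not_P)
    moreover have "glb_term S p \<noteq> Some (Fun f)" for f
      using glb_term_Some_iff[OF s, of "Fun f" p] False by simp
    ultimately show ?thesis by simp
  qed
qed

lemma is_glb_glb_term: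
  assumes S: "S \<noteq> {}" and wf: "\<And>s. s \<in> S \<Longrightarrow> wf_term ar s"
  shows "is_glb ar S (glb_term S)"
  unfolding is_glb_def
proof (intro conjI ballI allI impI)
  show wfG: "wf_term ar (glb_term S)" by (rule wf_glb_term[OF assms])
  show "le_bot (glb_term S) s" if s: "s \<in> S" for s
    using wfG wf[OF s] by (rule le_botI) (simp add: glb_term_Some_iff[OF s])
  fix h
  assume "wf_term ar h \<and> (\<forall>s\<in>S. le_bot h s)"
  then have h: "wf_term ar h" "\<And>s. s \<in> S \<Longrightarrow> le_bot h s" by auto
  obtain s where s: "s \<in> S" using S by blast
  show "le_bot h (glb_term S)"
    using h(1) wfG
  proof (rule le_botI)
    fix p a
    assume pa: "h p = Some a" "a \<noteq> Bot"
    have "agree S q" if q: "prefix q p" for q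
    proof -
      have "h q \<noteq> None" "h q \<noteq> Some Bot"
        using q pa wf_term_strict_prefix[OF h(1), of p q] by (auto simp: prefix_order.le_less)
      then obtain b where "h q = Some b" "b \<noteq> Bot" by auto
      then have *: "s q = Some b" if "s \<in> S" for s
        using le_bot_Some[OF h(2)[OF that]] by blast
      show ?thesis unfolding agree_def by (intro ballI trans[OF * *[symmetric]])
    qed
    then show "glb_term S p = Some a"
      using glb_term_Some_iff[OF s pa(2)] le_bot_Some[OF h(2)[OF s] pa] by simp
  qed
qed

lemma is_glb_unique: "is_glb ar S g \<Longrightarrow> is_glb ar S g' \<Longrightarrow> g = g'"
  unfolding is_glb_def by (intro le_bot_antisym) auto

text \<open>Constancy is required on the whole path to \<open>p\<close>: a disagreement above
  \<open>p\<close> puts \<open>Bot\<close> there into the meet and removes \<open>p\<close> from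
  it.\<close>

definition stable_from :: "('i::wellorder \<Rightarrow> ('f, 'v) pterm) \<Rightarrow> 'i \<Rightarrow> 'i \<Rightarrow> pos \<Rightarrow> ('f, 'v) sym \<Rightarrow> bool" where
  "stable_from c \<beta> \<alpha> p a \<longleftrightarrow>
     (\<forall>\<iota>. \<beta> \<le> \<iota> \<and> \<iota> < \<alpha> \<longrightarrow> c \<iota> p = Some a \<and> (\<forall>q. prefix q p \<longrightarrow> c \<iota> q = c \<beta> q))"

lemma stable_fromD: "stable_from c \<beta> \<alpha> p a \<Longrightarrow> \<beta> \<le> \<iota> \<Longrightarrow> \<iota> < \<alpha> \<Longrightarrow> c \<iota> p = Some a"
  unfolding stable_from_def by blast

lemma glb_term_tail:
  assumes "\<beta> < \<alpha>" "a \<noteq> Bot"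
  shows "glb_term {c \<iota> | \<iota>. \<beta> \<le> \<iota> \<and> \<iota> < \<alpha>} p = Some a \<longleftrightarrow> stable_from c \<beta> \<alpha> p a"
    (is "glb_term ?S p = _ \<longleftrightarrow> _")
proof -
  have \<beta>: "c \<beta> \<in> ?S" using assms(1) by auto
  have agree: "agree ?S q \<longleftrightarrow> (\<forall>\<iota>. \<beta> \<le> \<iota> \<and> \<iota> < \<alpha> \<longrightarrow> c \<iota> q = c \<beta> q)" for q
  proof
    assume "agree ?S q"
    then show "\<forall>\<iota>. \<beta> \<le> \<iota> \<and> \<iota> < \<alpha> \<longrightarrow> c \<iota> q = c \<beta> q"
      using \<beta> unfolding agree_def by blast
  next
    assume *: "\<forall>\<iota>. \<beta> \<le> \<iota> \<and> \<iota> < \<alpha> \<longrightarrow> c \<iota> q = c \<beta> q"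
    show "agree ?S q"
      unfolding agree_def
    proof (intro ballI)
      fix s s'
      assume "s \<in> ?S" "s' \<in> ?S"
      then obtain \<iota> \<kappa> where "s = c \<iota>" "\<beta> \<le> \<iota>" "\<iota> < \<alpha>" "s' = c \<kappa>" "\<beta> \<le> \<kappa>" "\<kappa> < \<alpha>" by blast
      with * show "s q = s' q" by metis
    qed
  qed
  show ?thesis
    unfolding glb_term_Some_iff[OF \<beta> assms(2)] agree stable_from_def
    using assms(1) by (metis order_refl prefix_order.order_refl)
qed

text \<open>Uniqueness of meets lets the explicit ones replace the existentially quantified family
  in \<open>is_liminf\<close>.\<close>

lemma is_liminf_glb_term_iff:
  assumes wf: "\<And>\<iota>. \<iota> < \<alpha> \<Longrightarrow> wf_term ar (c \<iota>)"
  shows "is_liminf ar c \<alpha> t \<longleftrightarrow>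
    is_lub ar ((\<lambda>\<beta>. glb_term {c \<iota> | \<iota>. \<beta> \<le> \<iota> \<and> \<iota> < \<alpha>}) ` {..<\<alpha>}) t"
proof -
  have glb: "is_glb ar {c \<iota> | \<iota>. \<beta> \<le> \<iota> \<and> \<iota> < \<alpha>} (glb_term {c \<iota> | \<iota>. \<beta> \<le> \<iota> \<and> \<iota> < \<alpha>})"
    if "\<beta> < \<alpha>" for \<beta>
    by (rule is_glb_glb_term) (use that wf in auto)
  have unique: "g ` {..<\<alpha>} = (\<lambda>\<beta>. glb_term {c \<iota> | \<iota>. \<beta> \<le> \<iota> \<and> \<iota> < \<alpha>}) ` {..<\<alpha>}"
    if "\<forall>\<beta><\<alpha>. is_glb ar {c \<iota> | \<iota>. \<beta> \<le> \<iota> \<and> \<iota> < \<alpha>} (g \<beta>)" for g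
    by (intro image_cong refl is_glb_unique[OF that[rule_format] glb]) simp_all
  show ?thesis
  proof
    assume "is_liminf ar c \<alpha> t"
    then obtain g where "\<forall>\<beta><\<alpha>. is_glb ar {c \<iota> | \<iota>. \<beta> \<le> \<iota> \<and> \<iota> < \<alpha>} (g \<beta>)" "is_lub ar (g ` {..<\<alpha>}) t"
      unfolding is_liminf_def by blast
    then show "is_lub ar ((\<lambda>\<beta>. glb_term {c \<iota> | \<iota>. \<beta> \<le> \<iota> \<and> \<iota> < \<alpha>}) ` {..<\<alpha>}) t"
      by (simp only: unique)
  next
    assume "is_lub ar ((\<lambda>\<beta>. glb_term {c \<iota> | \<iota>. \<beta> \<le> \<iota> \<and> \<iota> < \<alpha>}) ` {..<\<alpha>}) t"
    then show "is_liminf ar c \<alpha> t"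
      unfolding is_liminf_def using glb
      by (intro exI[of _ "\<lambda>\<beta>. glb_term {c \<iota> | \<iota>. \<beta> \<le> \<iota> \<and> \<iota> < \<alpha>}"] conjI allI impI)
  qed
qed

text \<open>By \<open>stab\<close>, every proper label of \<open>t\<close> occurs in some meet, so
  \<open>t\<close> lies below each upper bound of the meets. Together with \<open>bot\<close> it
  makes \<open>t\<close> an upper bound itself, since no meet keeps a proper label at a position
  that is cofinally undefined or \<open>Bot\<close>.\<close>

lemma is_liminfI:
  assumes wf: "\<And>\<iota>. \<iota> < \<alpha> \<Longrightarrow> wf_term ar (c \<iota>)" "wf_term ar t"
    and stab: "\<And>p a. t p = Some a \<Longrightarrow> a \<noteq> Bot \<Longrightarrow> \<exists>\<beta><\<alpha>. stable_from c \<beta> \<alpha> p a"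
    and bot: "\<And>p \<beta>. t p = Some Bot \<Longrightarrow> \<beta> < \<alpha> \<Longrightarrow>
      \<exists>\<iota>. \<beta> \<le> \<iota> \<and> \<iota> < \<alpha> \<and> (c \<iota> p = None \<or> c \<iota> p = Some Bot)"
  shows "is_liminf ar c \<alpha> t"
proof -
  let ?g = "\<lambda>\<beta>. glb_term {c \<iota> | \<iota>. \<beta> \<le> \<iota> \<and> \<iota> < \<alpha>}"
  have wfg: "wf_term ar (?g \<beta>)" if "\<beta> < \<alpha>" for \<beta>
    by (rule wf_glb_term) (use that wf in auto)
  have "le_bot (?g \<beta>) t" if \<beta>: "\<beta> < \<alpha>" for \<beta>
    using wfg[OF \<beta>] wf(2)
  proof (rule le_botI)
    fix p a
    assume pa: "?g \<beta> p = Some a" "a \<noteq> Bot" "t p \<noteq> None"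
    then have st: "stable_from c \<beta> \<alpha> p a" by (simp only: glb_term_tail[OF \<beta> pa(2)])
    obtain b where b: "t p = Some b" using pa(3) by auto
    show "t p = Some a"
    proof (cases "b = Bot")
      case True
      then obtain \<iota> where "\<beta> \<le> \<iota>" "\<iota> < \<alpha>" "c \<iota> p = None \<or> c \<iota> p = Some Bot"
        using bot[of p \<beta>] b \<beta> by auto
      then show ?thesis using stable_fromD[OF st] pa(2) by force
    next
      case False
      then obtain \<beta>' where "\<beta>' < \<alpha>" "stable_from c \<beta>' \<alpha> p b" using stab b by blast
      then have "c (max \<beta> \<beta>') p = Some a" "c (max \<beta> \<beta>') p = Some b"
        using st \<beta> by (auto intro: stable_fromD)
      then show ?thesis using b by simp
    qed
  qed
  moreover have "le_bot t h" if h: "wf_term ar h" "\<forall>s\<in>?g ` {..<\<alpha>}. le_bot s h" for h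
    using wf(2) h(1)
  proof (rule le_botI)
    fix p a
    assume tp: "t p = Some a" and a: "a \<noteq> Bot"
    then obtain \<beta> where \<beta>: "\<beta> < \<alpha>" "stable_from c \<beta> \<alpha> p a" using stab by blast
    then have gp: "?g \<beta> p = Some a" by (simp only: glb_term_tail[OF \<beta>(1) a])
    have "le_bot (?g \<beta>) h" using h(2) \<beta>(1) by blast
    then show "h p = Some a" using gp a by (rule le_bot_Some)
  qed
  ultimately have "is_lub ar (?g ` {..<\<alpha>}) t"
    unfolding is_lub_def using wf(2) by blast
  then show ?thesis by (subst is_liminf_glb_term_iff) (use wf in blast)+
qed

lemma is_liminf_wf: "is_liminf ar c \<alpha> t \<Longrightarrow> wf_term ar t"
  by (auto simp: is_liminf_def is_lub_def)

lemma is_liminf_Some_iff: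
  assumes lim: "is_liminf ar c \<alpha> t"
    and wf: "\<And>\<iota>. \<iota> < \<alpha> \<Longrightarrow> wf_term ar (c \<iota>)"
    and a: "a \<noteq> Bot"
  shows "t p = Some a \<longleftrightarrow> (\<exists>\<beta><\<alpha>. stable_from c \<beta> \<alpha> p a)"
proof -
  let ?g = "\<lambda>\<beta>. glb_term {c \<iota> | \<iota>. \<beta> \<le> \<iota> \<and> \<iota> < \<alpha>}"
  have wfg: "wf_term ar (?g \<beta>)" if "\<beta> < \<alpha>" for \<beta>
    by (rule wf_glb_term) (use that wf in auto)
  have lub: "wf_term ar t" "\<And>\<beta>. \<beta> < \<alpha> \<Longrightarrow> le_bot (?g \<beta>) t"
    "\<And>h. wf_term ar h \<Longrightarrow> (\<And>\<beta>. \<beta> < \<alpha> \<Longrightarrow> le_bot (?g \<beta>) h) \<Longrightarrow> le_bot t h"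
    using is_liminf_glb_term_iff[of \<alpha> ar c t] wf lim unfolding is_lub_def by blast+
  have "\<exists>\<beta><\<alpha>. ?g \<beta> p = Some a" if tp: "t p = Some a"
  proof (rule ccontr)
    \<comment> \<open>Otherwise cutting \<open>t\<close> at \<open>p\<close> gives a smaller upper bound.\<close>
    assume no: "\<not> ?thesis"
    let ?h = "replace t p bot_term"
    have wfh: "wf_term ar ?h" using lub(1) tp by (intro wf_replace) auto
    have "le_bot (?g \<beta>) ?h" if \<beta>: "\<beta> < \<alpha>" for \<beta>
      using wfg[OF \<beta>] wfh
    proof (rule le_botI)
      fix q b
      assume q: "?g \<beta> q = Some b" "b \<noteq> Bot"
      have tq: "t q = Some b" using le_bot_Some[OF lub(2)[OF \<beta>] q] .
      have "\<not> prefix p q"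
      proof
        assume "prefix p q"
        then have "?g \<beta> p \<noteq> None \<and> ?g \<beta> p \<noteq> Some Bot"
          using q wf_term_strict_prefix[OF wfg[OF \<beta>], of q p] by (auto simp: prefix_order.le_less)
        then show False
          using no \<beta> tp lub(2)[OF \<beta>, unfolded le_bot_def, rule_format, of p] by auto
      qed
      then show "?h q = Some b" using tq by (simp add: replace_outside)
    qed
    then have "le_bot t ?h" by (rule lub(3)[OF wfh])
    from le_bot_Some[OF this tp a] show False using a by simp
  qed
  moreover have "t p = Some a" if "\<beta> < \<alpha>" "?g \<beta> p = Some a" for \<beta>
    using le_bot_Some[OF lub(2)[OF that(1)] that(2) a] .
  ultimately have "t p = Some a \<longleftrightarrow> (\<exists>\<beta><\<alpha>. ?g \<beta> p = Some a)" by blast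
  also have "\<dots> \<longleftrightarrow> (\<exists>\<beta><\<alpha>. stable_from c \<beta> \<alpha> p a)"
    by (intro ex_cong1 conj_cong refl glb_term_tail a)
  finally show ?thesis .
qed

section \<open>Substitutions and rewrite steps\<close>

text \<open>Variables are leaves, so two of them on one path coincide. This pins down the choice
  made by \<open>SOME\<close> in \<open>subst\<close>.\<close>

lemma prefix_Var_unique:
  assumes "wf_term ar l" "l p = Some (Var x)" "l q = Some (Var y)" "prefix p r" "prefix q r"
  shows "p = q"
proof -
  have "\<not> strict_prefix p q" "\<not> strict_prefix q p"
    using wf_term_strict_prefix[OF assms(1)] assms(2,3) by fastforce+
  then show ?thesis
    using prefix_same_cases[OF assms(4,5)] by (auto simp: prefix_order.le_less)
qed

lemma subst_Var:
  assumes "wf_term ar l" "l p = Some (Var x)"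
  shows "subst \<sigma> l (p @ q) = \<sigma> x q"
proof -
  have "(SOME (q1, y). take (length q1) (p @ q) = q1 \<and> l q1 = Some (Var y)) = (p, x)"
    (is "Eps ?P = _")
  proof (rule some_equality)
    fix z
    assume z: "?P z"
    obtain q1 y where z_eq: "z = (q1, y)" by (cases z)
    have "prefix q1 (p @ q)" "l q1 = Some (Var y)"
      using z take_length_eq_iff_prefix[of q1 "p @ q"] by (simp_all add: z_eq del: take_append)
    then show "z = (p, x)"
      using prefix_Var_unique[OF assms(1) \<open>l q1 = _\<close> assms(2), of "p @ q"] assms(2) z_eq by auto
  qed (use assms(2) in simp)
  then show ?thesis using assms(2) by (auto simp: subst_def)
qed

lemma subst_no_Var:
  "(\<And>p x. prefix p q \<Longrightarrow> l p \<noteq> Some (Var x)) \<Longrightarrow> subst \<sigma> l q = l q"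
  by (auto simp: subst_def prefix_def)

lemma subst_root: "l [] = Some a \<Longrightarrow> (\<And>x. a \<noteq> Var x) \<Longrightarrow> subst \<sigma> l [] = Some a"
  by (subst subst_no_Var) auto

lemma subterm_subst:
  assumes "wf_term ar l" "l p \<noteq> None"
  shows "subterm (subst \<sigma> l) p = subst \<sigma> (subterm l p)"
proof
  fix q
  show "subterm (subst \<sigma> l) p q = subst \<sigma> (subterm l p) q"
  proof (cases "\<exists>q1 x. prefix q1 (p @ q) \<and> l q1 = Some (Var x)")
    case True
    then obtain q1 x where q1: "prefix q1 (p @ q)" "l q1 = Some (Var x)" by blast
    have "\<not> strict_prefix q1 p" using wf_term_strict_prefix[OF assms, of q1] q1(2) by auto
    then have "prefix p q1" using q1(1) by (auto simp: prefix_append prefix_order.less_le)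
    then obtain r where r: "q1 = p @ r" by (auto simp: prefix_def)
    then obtain q2 where q2: "q = r @ q2" using q1(1) by (auto simp: prefix_def)
    have "subterm l p r = Some (Var x)" using q1(2) r by simp
    then have "subst \<sigma> (subterm l p) q = \<sigma> x q2"
      unfolding q2 by (rule subst_Var[OF wf_subterm[OF assms]])
    then show ?thesis using subst_Var[OF assms(1) q1(2), of \<sigma> q2] r q2 by simp
  next
    case False
    then have "subst \<sigma> l (p @ q) = l (p @ q)" by (intro subst_no_Var) blast
    moreover have "subst \<sigma> (subterm l p) q = subterm l p q"
      using False by (intro subst_no_Var) auto
    ultimately show ?thesis by simp
  qed
qed

lemma subst_Var_root: "wf_term ar l \<Longrightarrow> l [] = Some (Var x) \<Longrightarrow> subst \<sigma> l = \<sigma> x"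
  using subst_Var[of ar l "[]"] by (simp add: fun_eq_iff)

lemma vars_subterm: "vars (subterm l p) \<subseteq> vars l"
  by (auto simp: vars_def)

text \<open>A rewrite step does not ask its substitution to consist of well-formed terms, so this
  has to be recovered from the redex. The doubtful point is that \<open>\<sigma> x\<close> has a
  root; unless \<open>l\<close> is itself the variable, this comes from the parent of
  \<open>x\<close>, whose symbol survives in the instance and has the required arity.\<close>

lemma wf_subst_Var:
  assumes "wf_term ar l" "wf_term ar (subst \<sigma> l)" "x \<in> vars l"
  shows "wf_term ar (\<sigma> x)"
proof -
  obtain p where p: "l p = Some (Var x)" using assms(3) by (auto simp: vars_def)
  have eq: "subterm (subst \<sigma> l) p = \<sigma> x"
    using subst_Var[OF assms(1) p] by (simp add: fun_eq_iff)
  show ?thesis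
  proof (cases "p = []")
    case True
    then show ?thesis using assms(2) eq by simp
  next
    case False
    then obtain q i where q: "p = q @ [i]" by (cases p rule: rev_cases) auto
    then obtain f where f: "l q = Some (Fun f)" "i < ar f"
      using wf_term_child_iff[OF assms(1), of q i] p by auto
    have "subst \<sigma> l q = l q"
    proof (rule subst_no_Var)
      fix q1 y
      assume "prefix q1 q"
      then have "strict_prefix q1 p" using q by (auto simp: strict_prefix_def prefix_def)
      then show "l q1 \<noteq> Some (Var y)"
        using wf_term_strict_prefix[OF assms(1), of p q1] p by auto
    qed
    then have "subst \<sigma> l p \<noteq> None"
      using wf_term_child_iff[OF assms(2), of q i] f q by auto
    then show ?thesis using wf_subterm[OF assms(2), of p] eq by simp
  qed
qed

lemma wf_subst:
  assumes "wf_term ar l" "\<And>x. x \<in> vars l \<Longrightarrow> wf_term ar (\<sigma> x)"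
  shows "wf_term ar (subst \<sigma> l)"
proof (rule wf_termI)
  have root: "subst \<sigma> l p \<noteq> None" if "l p \<noteq> None" for p
  proof (cases "\<exists>x. l p = Some (Var x)")
    case True
    then obtain x where x: "l p = Some (Var x)" ..
    then have "wf_term ar (\<sigma> x)" by (intro assms(2)) (auto simp: vars_def)
    then show ?thesis using subst_Var[OF assms(1) x, of \<sigma> "[]"] wf_term_Nil by force
  next
    case False
    have "subst \<sigma> l p = l p"
    proof (rule subst_no_Var)
      fix q1 y
      assume "prefix q1 p"
      then show "l q1 \<noteq> Some (Var y)"
        using False wf_term_strict_prefix[OF assms(1) that, of q1] by (auto simp: prefix_order.le_less)
    qed
    then show ?thesis using that by simp
  qed
  show "subst \<sigma> l [] \<noteq> None" using root wf_term_Nil[OF assms(1)] by simp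
  fix q i
  show "subst \<sigma> l (q @ [i]) \<noteq> None \<longleftrightarrow> (\<exists>f. subst \<sigma> l q = Some (Fun f) \<and> i < ar f)"
  proof (cases "\<exists>q1 x. prefix q1 q \<and> l q1 = Some (Var x)")
    case True
    then obtain q1 q2 x where x: "q = q1 @ q2" "l q1 = Some (Var x)" by (auto simp: prefix_def)
    then have "wf_term ar (\<sigma> x)" by (intro assms(2)) (auto simp: vars_def)
    then show ?thesis
      using wf_term_child_iff[of ar "\<sigma> x" q2 i] subst_Var[OF assms(1) x(2)] by (simp add: x(1))
  next
    case False
    then have q: "subst \<sigma> l q = l q" by (intro subst_no_Var) blast
    have "subst \<sigma> l (q @ [i]) \<noteq> None \<longleftrightarrow> l (q @ [i]) \<noteq> None"
    proof (cases "l (q @ [i]) = None")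
      case True
      have "subst \<sigma> l (q @ [i]) = l (q @ [i])"
        using False True by (intro subst_no_Var) auto
      then show ?thesis by simp
    next
      case False
      then show ?thesis using root by simp
    qed
    then show ?thesis using q wf_term_child_iff[OF assms(1), of q i] by simp
  qed
qed

lemma subst_cong:
  assumes "wf_term ar l" "\<And>x. x \<in> vars l \<Longrightarrow> \<sigma> x = \<tau> x"
  shows "subst \<sigma> l = subst \<tau> l"
proof
  fix q
  show "subst \<sigma> l q = subst \<tau> l q"
  proof (cases "\<exists>q1 x. prefix q1 q \<and> l q1 = Some (Var x)")
    case True
    then obtain q1 q2 x where x: "q = q1 @ q2" "l q1 = Some (Var x)" by (auto simp: prefix_def)
    then have "\<sigma> x = \<tau> x" by (intro assms(2)) (auto simp: vars_def)
    then show ?thesis using subst_Var[OF assms(1) x(2)] x(1) by simp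
  next
    case False
    then have "subst \<rho> l q = l q" for \<rho> by (intro subst_no_Var) blast
    then show ?thesis by simp
  qed
qed

section \<open>Rewrite steps inside and beside a subterm\<close>

lemma rstep_at: "rstep R t p u \<Longrightarrow> t p \<noteq> None"
  by (simp add: rstep_def)

lemma rstep_replace: "rstep R u q v \<Longrightarrow> rstep R (replace t p u) (p @ q) (replace t p v)"
  unfolding rstep_def by (auto simp: replace_append_pos simp flip: subterm_subterm)

lemma rstep_subterm:
  assumes "rstep R t (p @ q) u"
  shows "rstep R (subterm t p) q (subterm u p)"
proof -
  obtain l r \<sigma> where "(l, r) \<in> R" "t (p @ q) \<noteq> None" "subterm t (p @ q) = subst \<sigma> l"
    "u = replace t (p @ q) (subst \<sigma> r)"
    using assms by (auto simp: rstep_def)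
  then show ?thesis
    unfolding rstep_def by (auto simp: replace_append_pos intro!: bexI[of _ "(l, r)"])
qed

lemma rstep_outside: "rstep R t p u \<Longrightarrow> \<not> prefix p q \<Longrightarrow> u q = t q"
  by (auto simp: rstep_def replace_outside)

lemma rstep_parallel:
  "rstep R t p u \<Longrightarrow> \<not> prefix p q \<Longrightarrow> \<not> prefix q p \<Longrightarrow> subterm u q = subterm t q"
  by (auto simp: rstep_def subterm_replace_parallel)

lemma rstep_wf:
  assumes "is_TRS ar R" "wf_term ar t" "rstep R t p u"
  shows "wf_term ar u"
proof -
  obtain l r \<sigma> where lr: "(l, r) \<in> R" "t p \<noteq> None" "subterm t p = subst \<sigma> l"
    "u = replace t p (subst \<sigma> r)"
    using assms(3) by (auto simp: rstep_def)
  have wf: "wf_term ar l" "wf_term ar r" "vars r \<subseteq> vars l"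
    using assms(1) lr(1) by (auto simp: is_TRS_def total_term_def)
  have "wf_term ar (subst \<sigma> l)" using wf_subterm[OF assms(2) lr(2)] lr(3) by simp
  then have "wf_term ar (\<sigma> x)" if "x \<in> vars r" for x
    using wf_subst_Var[OF wf(1)] wf(3) that by blast
  then have "wf_term ar (subst \<sigma> r)" by (rule wf_subst[OF wf(2)])
  then show ?thesis unfolding lr(4) by (rule wf_replace[OF assms(2) lr(2)])
qed

section \<open>Finite reductions\<close>

inductive fred :: "('f, 'v) rule set \<Rightarrow> ('f, 'v) pterm \<Rightarrow> pos list \<Rightarrow> ('f, 'v) pterm \<Rightarrow> bool" for R where
  Nil: "fred R s [] s"
| Cons: "rstep R s p u \<Longrightarrow> fred R u ps t \<Longrightarrow> fred R s (p # ps) t"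

inductive_cases fred_NilE: "fred R s [] t"

lemma fred_Nil_iff [simp]: "fred R s [] t \<longleftrightarrow> s = t"
  by (auto intro: fred.Nil elim: fred_NilE)

lemma fred_append: "fred R s ps u \<Longrightarrow> fred R u qs t \<Longrightarrow> fred R s (ps @ qs) t"
  by (induction rule: fred.induct) (auto intro: fred.Cons)

lemma fred_snoc: "fred R s ps u \<Longrightarrow> rstep R u p t \<Longrightarrow> fred R s (ps @ [p]) t"
  by (rule fred_append) (auto intro: fred.intros)

lemma fred_wf: "fred R s ps t \<Longrightarrow> is_TRS ar R \<Longrightarrow> wf_term ar s \<Longrightarrow> wf_term ar t"
  by (induction rule: fred.induct) (auto intro: rstep_wf)

lemma fred_replace:
  "fred R u ps v \<Longrightarrow> fred R (replace t p u) (map ((@) p) ps) (replace t p v)"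
  by (induction rule: fred.induct) (auto intro: fred.intros rstep_replace)

text \<open>Arguments occupy disjoint positions, so they can be reduced one after another;
  \<open>m\<close> counts those already treated. The set of contracted positions is recorded for the
  fair strategy, which must know where it has contracted.\<close>

lemma fred_args_less:
  assumes "\<And>i. i < m \<Longrightarrow> u [i] \<noteq> None \<Longrightarrow> fred R (subterm u [i]) (ps i) (v i)"
  shows "\<exists>qs w. fred R u qs w \<and> w [] = u [] \<and>
    (\<forall>i. u [i] \<noteq> None \<longrightarrow> subterm w [i] = (if i < m then v i else subterm u [i])) \<and>
    set qs = (\<Union>i\<in>{i. i < m \<and> u [i] \<noteq> None}. (#) i ` set (ps i))"
  using assms
proof (induction m)
  case 0
  show ?case by (intro exI[of _ "[]"] exI[of _ u]) simp
next
  case (Suc m)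
  from Suc.prems have "\<And>i. i < m \<Longrightarrow> u [i] \<noteq> None \<Longrightarrow> fred R (subterm u [i]) (ps i) (v i)"
    using less_SucI by blast
  from Suc.IH[OF this]
  obtain qs w where w: "fred R u qs w" "w [] = u []"
    "\<And>i. u [i] \<noteq> None \<Longrightarrow> subterm w [i] = (if i < m then v i else subterm u [i])"
    "set qs = (\<Union>i\<in>{i. i < m \<and> u [i] \<noteq> None}. (#) i ` set (ps i))"
    by blast
  show ?case
  proof (cases "u [m] = None")
    case True
    then have "{i. i < Suc m \<and> u [i] \<noteq> None} = {i. i < m \<and> u [i] \<noteq> None}"
      using less_Suc_eq by auto
    moreover have "subterm w [i] = (if i < Suc m then v i else subterm u [i])" if "u [i] \<noteq> None" for i
      using w(3)[OF that] that True less_Suc_eq by auto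
    ultimately show ?thesis using w(1,2,4) by metis
  next
    case False
    let ?w = "replace w [m] (v m)"
    have "fred R (subterm w [m]) (ps m) (v m)" using w(3)[OF False] Suc.prems[of m] False by (simp del: subterm_app)
    from fred_append[OF w(1) fred_replace[OF this, of w "[m]", simplified]]
    have "fred R u (qs @ map ((#) m) (ps m)) ?w" by (simp add: fun_eq_iff cong: map_cong)
    moreover have "?w [] = u []" using w(2) by (simp add: replace_def)
    moreover have "subterm ?w [i] = (if i < Suc m then v i else subterm u [i])"
      if "u [i] \<noteq> None" for i
      using w(3)[OF that] by (cases "i = m") (auto simp: subterm_replace_parallel)
    moreover have "{i. i < Suc m \<and> u [i] \<noteq> None} = insert m {i. i < m \<and> u [i] \<noteq> None}"
      using False less_Suc_eq by auto
    then have "set (qs @ map ((#) m) (ps m))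
        = (\<Union>i\<in>{i. i < Suc m \<and> u [i] \<noteq> None}. (#) i ` set (ps i))"
      using w(4) by auto
    ultimately show ?thesis by blast
  qed
qed

lemma fred_args:
  assumes "wf_term ar u"
    and "\<And>i. u [i] \<noteq> None \<Longrightarrow> fred R (subterm u [i]) (ps i) (v i)"
  obtains qs w where "fred R u qs w" "w [] = u []"
    "\<And>i. u [i] \<noteq> None \<Longrightarrow> subterm w [i] = v i"
    "set qs = (\<Union>i\<in>{i. u [i] \<noteq> None}. (#) i ` set (ps i))"
proof -
  obtain m where m: "\<forall>i\<ge>m. u [i] = None"
    using wf_term_bounded_children[OF assms(1)] ..
  then have less: "i < m" if "u [i] \<noteq> None" for i
    using m that by (cases "i < m") auto
  then have "{i. i < m \<and> u [i] \<noteq> None} = {i. u [i] \<noteq> None}" by auto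
  moreover obtain qs w where "fred R u qs w" "w [] = u []"
    "\<And>i. u [i] \<noteq> None \<Longrightarrow> subterm w [i] = (if i < m then v i else subterm u [i])"
    "set qs = (\<Union>i\<in>{i. i < m \<and> u [i] \<noteq> None}. (#) i ` set (ps i))"
    using fred_args_less[of m u R ps v, OF assms(2)] by blast
  ultimately show thesis using less that by simp
qed

lemma wf_term_eq_args:
  assumes "wf_term ar s" "wf_term ar t" "s [] = t []"
    "\<And>i. t [i] \<noteq> None \<Longrightarrow> subterm s [i] = subterm t [i]"
  shows "s = t"
proof (rule wf_term_eqI[OF assms(1,2)])
  fix p a
  assume p: "t p = Some a"
  show "s p = Some a"
  proof (cases p)
    case (Cons i q)
    then have "t [i] \<noteq> None" using p wf_term_prefix[OF assms(2), of "[i]" q] by simp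
    from assms(4)[OF this] have "subterm s [i] q = subterm t [i] q" by simp
    then show ?thesis using p Cons by simp
  qed (use p assms(3) in simp)
qed

section \<open>Compressed reducibility\<close>

locale left_linear_TRS =
  fixes ar :: "'f \<Rightarrow> nat" and R :: "('f, 'v) rule set"
  assumes TRS: "is_TRS ar R" and linear: "left_linear R" and finite: "left_finite R"
begin

coinductive root_active :: "('f, 'v) pterm \<Rightarrow> bool" where
  "fred R s ps u \<Longrightarrow> rstep R u [] v \<Longrightarrow> root_active v \<Longrightarrow> root_active s"

coinductive conv :: "('f, 'v) pterm \<Rightarrow> ('f, 'v) pterm \<Rightarrow> bool" where
  Bot: "wf_term ar s \<Longrightarrow> fred R s ps bot_term \<Longrightarrow> conv s bot_term"
| Root_active: "wf_term ar s \<Longrightarrow> root_active s \<Longrightarrow> conv s bot_term"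
| Args: "wf_term ar s \<Longrightarrow> wf_term ar t \<Longrightarrow> fred R s ps u \<Longrightarrow> u [] = t [] \<Longrightarrow> t [] \<noteq> Some Bot \<Longrightarrow>
    (\<And>i. t [i] \<noteq> None \<Longrightarrow> conv (subterm u [i]) (subterm t [i])) \<Longrightarrow> conv s t"

lemma conv_wf: "conv s t \<Longrightarrow> wf_term ar s \<and> wf_term ar t"
  by (erule conv.cases) simp_all

lemma conv_ArgsE:
  assumes "conv s t" "t [] \<noteq> Some Bot"
  obtains ps u where "fred R s ps u" "u [] = t []"
    "\<And>i. t [i] \<noteq> None \<Longrightarrow> conv (subterm u [i]) (subterm t [i])"
  using assms by (auto elim: conv.cases)

lemma root_active_prepend: "fred R s ps u \<Longrightarrow> root_active u \<Longrightarrow> root_active s"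
  by (erule root_active.cases) (auto intro: root_active.intros fred_append)

lemma conv_prepend:
  assumes "fred R s ps u" "wf_term ar s" "conv u t"
  shows "conv s t"
  using assms(3)
proof cases
  case (Bot qs)
  then show ?thesis using conv.Bot assms(2) fred_append[OF assms(1)] by metis
next
  case Root_active
  then show ?thesis using conv.Root_active assms(2) root_active_prepend[OF assms(1)] by metis
next
  case (Args qs w)
  show ?thesis by (rule conv.Args[OF assms(2) Args(2) fred_append[OF assms(1) Args(3)] Args(4-6)])
qed

text \<open>A candidate pair has to answer only for \<open>Args\<close>. Pairs at bottom must be
  shown to lie in \<open>conv\<close> directly, so the two bottom clauses disappear from the
  coinductions below.\<close>

lemma conv_coinduct [consumes 1]:
  assumes "X s t"
    and "\<And>s t. X s t \<Longrightarrow> conv s t \<or> (wf_term ar s \<and> wf_term ar t \<and>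
      (\<exists>ps u. fred R s ps u \<and> u [] = t [] \<and> t [] \<noteq> Some Bot \<and>
        (\<forall>i. t [i] \<noteq> None \<longrightarrow> X (subterm u [i]) (subterm t [i]) \<or> conv (subterm u [i]) (subterm t [i]))))"
  shows "conv s t"
  using assms(1)
proof (rule conv.coinduct[of X])
  fix s t
  assume "X s t"
  from assms(2)[OF this]
  show "(\<exists>s' ps. s = s' \<and> t = bot_term \<and> wf_term ar s' \<and> fred R s' ps bot_term) \<or>
    (\<exists>s'. s = s' \<and> t = bot_term \<and> wf_term ar s' \<and> root_active s') \<or>
    (\<exists>s' t' ps u. s = s' \<and> t = t' \<and> wf_term ar s' \<and> wf_term ar t' \<and> fred R s' ps u \<and>
      u [] = t' [] \<and> t' [] \<noteq> Some Bot \<and>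
      (\<forall>i. t' [i] \<noteq> None \<longrightarrow> X (subterm u [i]) (subterm t' [i]) \<or> conv (subterm u [i]) (subterm t' [i])))"
  proof
    assume "conv s t"
    then show ?thesis by cases blast+
  qed blast
qed

lemma conv_refl:
  assumes "wf_term ar t"
  shows "conv t t"
proof -
  have "s = t \<and> wf_term ar t \<Longrightarrow> conv s t" for s t
  proof (induction rule: conv_coinduct)
    case (1 s t)
    show ?case
    proof (cases "t [] = Some Bot")
      case True
      then have "conv s t"
        using conv.Bot[of s "[]"] 1 wf_term_root_Bot by fastforce
      then show ?thesis ..
    next
      case False
      then show ?thesis
        using 1 wf_subterm by (intro disjI2 conjI exI[of _ "[]"] exI[of _ t]) (auto simp del: subterm_app)
    qed
  qed
  then show ?thesis using assms by blast
qed

text \<open>Right-hand sides may be infinite, hence coinduction: the candidates are pairs of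
  instances of one total term, a class closed under passing to arguments, and at a variable the pair
  is already in \<open>conv\<close>.\<close>

lemma conv_subst:
  assumes "total_term ar r" "\<And>x. x \<in> vars r \<Longrightarrow> conv (\<sigma> x) (\<tau> x)"
  shows "conv (subst \<sigma> r) (subst \<tau> r)"
proof -
  let ?X = "\<lambda>s t. \<exists>r. total_term ar r \<and> (\<forall>x\<in>vars r. conv (\<sigma> x) (\<tau> x)) \<and> s = subst \<sigma> r \<and> t = subst \<tau> r"
  have "?X s t \<Longrightarrow> conv s t" for s t
  proof (induction rule: conv_coinduct)
    case (1 s t)
    then obtain r where r: "total_term ar r" "\<And>x. x \<in> vars r \<Longrightarrow> conv (\<sigma> x) (\<tau> x)"
      and st: "s = subst \<sigma> r" "t = subst \<tau> r" by blast
    have wf: "wf_term ar r" using r(1) by (simp add: total_term_def)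
    have wfs: "wf_term ar s" "wf_term ar t"
      unfolding st using r(2) conv_wf by (blast intro!: wf_subst[OF wf])+
    obtain a where a: "r [] = Some a" using wf_term_Nil[OF wf] by auto
    show ?case
    proof (cases "\<exists>x. a = Var x")
      case True
      then obtain x where x: "r [] = Some (Var x)" using a by auto
      then have "conv (\<sigma> x) (\<tau> x)" using r(2) unfolding vars_def by blast
      then show ?thesis unfolding st subst_Var_root[OF wf x] ..
    next
      case False
      then have root: "subst \<rho> r [] = Some a" for \<rho> by (intro subst_root a) auto
      have "a \<noteq> Bot" using r(1) a by (auto simp: total_term_def)
      have child: "?X (subterm s [i]) (subterm t [i])" if "t [i] \<noteq> None" for i
      proof -
        have ri: "r [i] \<noteq> None"
          using that wf_term_child_iff[OF wfs(2), of "[]" i] wf_term_child_iff[OF wf, of "[]" i]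
            root[of \<tau>] a st(2) by simp
        have "total_term ar (subterm r [i])"
          using r(1) wf_subterm[OF wf ri] by (simp add: total_term_def)
        moreover have "\<forall>x\<in>vars (subterm r [i]). conv (\<sigma> x) (\<tau> x)"
          using r(2) vars_subterm[of r "[i]"] by blast
        ultimately show ?thesis unfolding st subterm_subst[OF wf ri] by blast
      qed
      show ?thesis
        using wfs root \<open>a \<noteq> Bot\<close> child st
        by (intro disjI2 conjI exI[of _ "[]"] exI[of _ s]) (simp_all del: subterm_app)
    qed
  qed
  then show ?thesis using assms by blast
qed

text \<open>Finiteness of \<open>l\<close> bounds the depth to be exposed by some \<open>n\<close>,
  so finitely many finite reductions suffice. The matching \<open>\<tau>\<close> may differ from
  \<open>\<sigma>\<close>: what lies below the pattern is only related to its counterpart, not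
  reduced to it.\<close>

lemma conv_lhs:
  assumes "conv s (subst \<sigma> l)" "total_term ar l" "linear_term l" "finite_term l"
  shows "\<exists>ps \<tau>. fred R s ps (subst \<tau> l) \<and> (\<forall>x\<in>vars l. conv (\<tau> x) (\<sigma> x))"
proof -
  have "finite (length ` {p. l p \<noteq> None})" using assms(4) by (simp add: finite_term_def)
  then obtain n where "\<forall>p. l p \<noteq> None \<longrightarrow> length p < n"
    unfolding finite_nat_set_iff_bounded by auto
  then show ?thesis
    using assms(1-3)
  proof (induction n arbitrary: s l)
    case 0
    then show ?case using wf_term_Nil by (fastforce simp: total_term_def)
  next
    case (Suc n)
    have wf: "wf_term ar l" using Suc.prems(3) by (simp add: total_term_def)
    obtain a where a: "l [] = Some a" using wf_term_Nil[OF wf] by auto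
    show ?case
    proof (cases "\<exists>x. a = Var x")
      case True
      then obtain x where x: "l [] = Some (Var x)" using a by auto
      have "y = x" if "y \<in> vars l" for y
      proof -
        obtain p where p: "l p = Some (Var y)" using \<open>y \<in> vars l\<close> by (auto simp: vars_def)
        then have "p = []" using wf_term_root_leaf[OF wf, of p] x by (cases "p = []") auto
        then show ?thesis using p x by simp
      qed
      then show ?thesis
        using Suc.prems(2) subst_Var_root[OF wf x]
        by (intro exI[of _ "[]"] exI[of _ "\<lambda>_. s"]) auto
    next
      case False
      have "a \<noteq> Bot" using Suc.prems(3) a by (auto simp: total_term_def)
      have root: "subst \<rho> l [] = Some a" for \<rho> using False by (intro subst_root a) auto
      from Suc.prems(2) obtain ps u where u: "fred R s ps u" "u [] = Some a"
        "\<And>i. subst \<sigma> l [i] \<noteq> None \<Longrightarrow> conv (subterm u [i]) (subterm (subst \<sigma> l) [i])"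
        using root \<open>a \<noteq> Bot\<close> by (auto elim!: conv_ArgsE)
      have wfs: "wf_term ar s" "wf_term ar (subst \<sigma> l)" using conv_wf[OF Suc.prems(2)] by auto
      have wfu: "wf_term ar u" using fred_wf[OF u(1) TRS wfs(1)] .
      have child: "u [i] \<noteq> None \<longleftrightarrow> l [i] \<noteq> None" "subst \<sigma> l [i] \<noteq> None \<longleftrightarrow> l [i] \<noteq> None" for i
        using wf_term_child_iff[OF wfs(2), of "[]" i] wf_term_child_iff[OF wf, of "[]" i]
          wf_term_child_iff[OF wfu, of "[]" i] root a u(2) by simp_all
      have "\<exists>qs \<tau>. fred R (subterm u [i]) qs (subst \<tau> (subterm l [i]))
          \<and> (\<forall>x\<in>vars (subterm l [i]). conv (\<tau> x) (\<sigma> x))" if i: "l [i] \<noteq> None" for i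
      proof (rule Suc.IH)
        show "\<forall>p. subterm l [i] p \<noteq> None \<longrightarrow> length p < n"
          using Suc.prems(1) by (metis Suc_less_eq append_Cons append_Nil length_Cons subterm_app)
        show "conv (subterm u [i]) (subst \<sigma> (subterm l [i]))"
          using u(3)[of i] child(2) i subterm_subst[OF wf i, of \<sigma>] by (simp del: subterm_app)
        show "total_term ar (subterm l [i])"
          using Suc.prems(3) wf_subterm[OF wf i] by (simp add: total_term_def)
        show "linear_term (subterm l [i])"
          using Suc.prems(4) unfolding linear_term_def by (metis subterm_app same_append_eq)
      qed
      then obtain qs \<tau> where \<tau>: "\<And>i. l [i] \<noteq> None \<Longrightarrow> fred R (subterm u [i]) (qs i) (subst (\<tau> i) (subterm l [i]))"
        "\<And>i x. l [i] \<noteq> None \<Longrightarrow> x \<in> vars (subterm l [i]) \<Longrightarrow> conv (\<tau> i x) (\<sigma> x)"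
        by metis
      obtain rs w where w: "fred R u rs w" "w [] = u []"
        "\<And>i. u [i] \<noteq> None \<Longrightarrow> subterm w [i] = subst (\<tau> i) (subterm l [i])"
        by (rule fred_args[OF wfu, of R qs "\<lambda>i. subst (\<tau> i) (subterm l [i])"])
          (use \<tau>(1) child(1) in blast)+
      \<comment> \<open>By linearity a variable occurs in only one argument, so the substitutions
        found for the arguments never compete and can be glued.\<close>
      define \<rho> where "\<rho> x = \<tau> (SOME i. x \<in> vars (subterm l [i])) x" for x
      have unique: "i = j" if "x \<in> vars (subterm l [i])" "x \<in> vars (subterm l [j])" for i j x
        using that Suc.prems(4) by (auto simp: vars_def linear_term_def)
      have \<rho>: "\<rho> x = \<tau> i x" if "x \<in> vars (subterm l [i])" for i x
        using that unique someI[of "\<lambda>i. x \<in> vars (subterm l [i])" i] unfolding \<rho>_def by metis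
      have vars: "\<exists>i. l [i] \<noteq> None \<and> x \<in> vars (subterm l [i])" if "x \<in> vars l" for x
      proof -
        obtain p where p: "l p = Some (Var x)" using \<open>x \<in> vars l\<close> by (auto simp: vars_def)
        with False a obtain i q where q: "p = i # q" by (cases p) auto
        then show ?thesis
          using p wf_term_prefix[OF wf, of "[i]" q] by (auto simp: vars_def)
      qed
      have conv: "conv (\<rho> x) (\<sigma> x)" if "x \<in> vars l" for x
        using vars[OF that] \<rho> \<tau>(2) by metis
      have "w = subst \<rho> l"
      proof (rule wf_term_eq_args)
        show "wf_term ar w" using fred_wf[OF w(1) TRS wfu] .
        show wf\<rho>: "wf_term ar (subst \<rho> l)" using conv conv_wf wf_subst[OF wf] by blast
        show "w [] = subst \<rho> l []" using w(2) u(2) root by simp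
        fix i
        assume "subst \<rho> l [i] \<noteq> None"
        then have i: "l [i] \<noteq> None"
          using wf_term_child_iff[OF wf\<rho>, of "[]" i] wf_term_child_iff[OF wf, of "[]" i] root a by simp
        have "subst (\<tau> i) (subterm l [i]) = subst \<rho> (subterm l [i])"
          using wf_subterm[OF wf i] \<rho> by (intro subst_cong) auto
        then show "subterm w [i] = subterm (subst \<rho> l) [i]"
          using w(3)[of i] i child(1) subterm_subst[OF wf i, of \<rho>] by (simp del: subterm_app)
      qed
      then show ?thesis using fred_append[OF u(1) w(1)] conv by blast
    qed
  qed
qed

text \<open>The contraction from \<open>v\<close> to \<open>w\<close> is kept explicit instead of
  being absorbed into \<open>conv s u\<close>, because it is the root step that
  \<open>root_active\<close> asks for at a limit.\<close>

lemma conv_root_step: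
  assumes "conv s t" "rstep R t [] u"
  obtains ps v w where "fred R s ps v" "rstep R v [] w" "conv w u"
proof -
  obtain l r \<sigma> where lr: "(l, r) \<in> R" "t = subst \<sigma> l" "u = subst \<sigma> r"
    using assms(2) by (auto simp: rstep_def)
  have l: "total_term ar l" "linear_term l" "finite_term l" "total_term ar r" "vars r \<subseteq> vars l"
    using lr(1) TRS linear finite by (auto simp: is_TRS_def left_linear_def left_finite_def)
  obtain ps \<tau> where \<tau>: "fred R s ps (subst \<tau> l)" "\<forall>x\<in>vars l. conv (\<tau> x) (\<sigma> x)"
    using conv_lhs[OF _ l(1-3)] assms(1) lr(2) by blast
  have "wf_term ar (subst \<tau> l)"
    using \<tau>(2) conv_wf l(1) by (intro wf_subst) (auto simp: total_term_def)
  then have "rstep R (subst \<tau> l) [] (subst \<tau> r)"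
    unfolding rstep_def using wf_term_Nil lr(1) by auto
  moreover have "conv (subst \<tau> r) u"
    unfolding lr(3) using \<tau>(2) l(5) by (intro conv_subst l(4)) blast
  ultimately show thesis using that \<tau>(1) by blast
qed

lemma conv_step: "conv s t \<Longrightarrow> rstep R t p u \<Longrightarrow> conv s u"
proof (induction p arbitrary: s t u)
  case Nil
  then obtain ps v w where v: "fred R s ps v" "rstep R v [] w" "conv w u"
    by (rule conv_root_step)
  then show ?case using conv_prepend[OF fred_snoc[OF v(1,2)]] conv_wf[OF Nil(1)] by blast
next
  case (Cons i p)
  have wf: "wf_term ar s" "wf_term ar t" using conv_wf[OF Cons.prems(1)] by auto
  have wfu: "wf_term ar u" using rstep_wf[OF TRS wf(2) Cons.prems(2)] .
  have tip: "t ([i] @ p) \<noteq> None" using rstep_at[OF Cons.prems(2)] by simp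
  then have ti: "t [i] \<noteq> None" by (rule wf_term_prefix[OF wf(2)])
  obtain f where f: "t [] = Some (Fun f)"
    using wf_term_Fun[OF wf(2), of "[]" "[i]"] ti by auto
  obtain ps v where v: "fred R s ps v" "v [] = t []"
    "\<And>j. t [j] \<noteq> None \<Longrightarrow> conv (subterm v [j]) (subterm t [j])"
    using conv_ArgsE[OF Cons.prems(1)] f by auto
  have root: "u [] = t []" using rstep_outside[OF Cons.prems(2), of "[]"] by simp
  have "conv (subterm v [j]) (subterm u [j])" if "u [j] \<noteq> None" for j
  proof -
    have tj: "t [j] \<noteq> None"
      using that wf_term_child_iff[OF wf(2), of "[]" j] wf_term_child_iff[OF wfu, of "[]" j] root by simp
    show ?thesis
    proof (cases "j = i")
      case True
      have "rstep R (subterm t [i]) p (subterm u [i])"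
        using rstep_subterm[of R t "[i]" p u] Cons.prems(2) by simp
      then show ?thesis using Cons.IH v(3)[OF ti] True by blast
    next
      case False
      then have "subterm u [j] = subterm t [j]"
        using rstep_parallel[OF Cons.prems(2), of "[j]"] by simp
      then show ?thesis using v(3)[OF tj] by simp
    qed
  qed
  then show ?case using conv.Args[OF wf(1) wfu v(1)] v(2) root f by simp
qed

end

section \<open>Transfinite reductions are compressible\<close>

lemma ord_zero_le: "ord_zero \<le> (i :: 'i::wellorder)"
  unfolding ord_zero_def by (rule Least_le) simp

text \<open>The bound \<open>\<gamma>\<close> guarantees an element above \<open>i\<close>; at a
  greatest element \<open>ord_succ\<close> would be a \<open>LEAST\<close> over the empty
  set.\<close>

lemma ord_succ_greater: "i < \<gamma> \<Longrightarrow> i < ord_succ (i :: 'i::wellorder)"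
  unfolding ord_succ_def by (rule LeastI)

lemma ord_succ_le: "i < \<gamma> \<Longrightarrow> ord_succ (i :: 'i::wellorder) \<le> \<gamma>"
  unfolding ord_succ_def by (rule Least_le)

lemma less_ord_succ_iff:
  assumes "i < (\<gamma> :: 'i::wellorder)"
  shows "j < ord_succ i \<longleftrightarrow> j \<le> i"
  using ord_succ_greater[OF assms] ord_succ_le[of i j] by (meson le_less_trans not_le)

lemma ord_cases:
  obtains (zero) "(\<gamma> :: 'i::wellorder) = ord_zero"
  | (succ) i where "i < \<gamma>" "\<gamma> = ord_succ i"
  | (limit) "is_limit \<gamma>"
  unfolding is_limit_def using ord_succ_le order_le_less by blast

lemma ord_interval_induct [consumes 1, case_names base succ limit]:
  assumes "\<beta> \<le> (\<gamma> :: 'i::wellorder)"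
    and "P \<beta>"
    and succ: "\<And>i. \<beta> \<le> i \<Longrightarrow> i < \<gamma> \<Longrightarrow> P i \<Longrightarrow> P (ord_succ i)"
    and limit: "\<And>l. \<beta> < l \<Longrightarrow> l \<le> \<gamma> \<Longrightarrow> is_limit l \<Longrightarrow> (\<And>i. \<beta> \<le> i \<Longrightarrow> i < l \<Longrightarrow> P i) \<Longrightarrow> P l"
  shows "P \<gamma>"
proof -
  have "\<beta> \<le> \<delta> \<Longrightarrow> \<delta> \<le> \<gamma> \<Longrightarrow> P \<delta>" for \<delta>
  proof (induction \<delta> rule: less_induct)
    case (less \<delta>)
    show ?case
    proof (cases "\<beta> = \<delta>")
      case False
      then have \<beta>: "\<beta> < \<delta>" using less.prems(1) by simp
      show ?thesis
      proof (cases \<delta> rule: ord_cases)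
        case zero
        then show ?thesis using \<beta> ord_zero_le[of \<beta>] by simp
      next
        case (succ i)
        then have "\<beta> \<le> i" using \<beta> less_ord_succ_iff[OF succ(1)] by blast
        then show ?thesis
          using succ less assms(3)[of i] by (metis less_le_trans order_less_imp_le)
      next
        case limit
        then show ?thesis using \<beta> less assms(4)[of \<delta>] by (metis order_less_imp_le order_less_le_trans)
      qed
    qed (use assms(2) in simp)
  qed
  then show ?thesis using assms(1) by blast
qed

text \<open>With the result stored as \<open>T \<alpha>\<close>, closed and open reductions are
  treated alike: the limit condition then covers \<open>\<alpha>\<close> as well.\<close>

locale transfinite_reduction = left_linear_TRS ar R
  for ar :: "'f \<Rightarrow> nat" and R :: "('f, 'v) rule set" +
  fixes \<alpha> :: "'i::wellorder" and T :: "'i \<Rightarrow> ('f, 'v) pterm" and ps :: "'i \<Rightarrow> pos"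
  assumes wf: "i \<le> \<alpha> \<Longrightarrow> wf_term ar (T i)"
    and step: "i < \<alpha> \<Longrightarrow> rstep R (T i) (ps i) (T (ord_succ i))"
    and lim: "l \<le> \<alpha> \<Longrightarrow> is_limit l \<Longrightarrow> is_liminf ar (\<lambda>i. replace (T i) (ps i) bot_term) l (T l)"
begin

definition ctxt :: "'i \<Rightarrow> ('f, 'v) pterm" where
  "ctxt i = replace (T i) (ps i) bot_term"

lemma liminf_ctxt: "l \<le> \<alpha> \<Longrightarrow> is_limit l \<Longrightarrow> is_liminf ar ctxt l (T l)"
  using lim unfolding ctxt_def .

lemma wf_ctxt: "i < \<alpha> \<Longrightarrow> wf_term ar (ctxt i)"
  unfolding ctxt_def using wf[of i] rstep_at[OF step[of i]] by (intro wf_replace) auto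

lemma liminf_Some_iff:
  assumes "l \<le> \<alpha>" "is_limit l" "a \<noteq> Bot"
  shows "T l p = Some a \<longleftrightarrow> (\<exists>\<beta><l. stable_from ctxt \<beta> l p a)"
  using is_liminf_Some_iff[OF liminf_ctxt[OF assms(1,2)] _ assms(3)] wf_ctxt assms(1)
  by (meson less_le_trans)

lemma ctxt_outside: "\<not> prefix (ps i) q \<Longrightarrow> ctxt i q = T i q"
  by (simp add: ctxt_def replace_outside)

lemma ctxt_Some:
  assumes "ctxt i q = Some a" "a \<noteq> Bot"
  shows "\<not> prefix (ps i) q" "T i q = Some a"
proof -
  show *: "\<not> prefix (ps i) q"
  proof
    assume "prefix (ps i) q"
    then obtain r where "q = ps i @ r" by (auto simp: prefix_def)
    then show False using assms by (cases "r = []") (auto simp: ctxt_def)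
  qed
  show "T i q = Some a" using assms(1) ctxt_outside[OF *] by simp
qed

text \<open>At a limit the contexts agree with \<open>T \<beta>\<close> on the whole path, since no
  contraction reaches it, so proper labels persist. \<open>Bot\<close> needs its own argument,
  because limits are described by proper labels only: the parent forces the position to exist, and a
  proper label there would show in contexts that have \<open>Bot\<close>.\<close>

lemma unchanged:
  assumes "\<beta> \<le> \<gamma>" "\<gamma> \<le> \<alpha>"
    and out: "\<And>i. \<beta> \<le> i \<Longrightarrow> i < \<gamma> \<Longrightarrow> \<not> prefix (ps i) q"
    and "T \<beta> q \<noteq> None"
  shows "\<forall>r. prefix r q \<longrightarrow> T \<gamma> r = T \<beta> r"
  using assms(1)
proof (induction rule: ord_interval_induct)
  case (succ i)
  then have "\<not> prefix (ps i) r" if "prefix r q" for r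
    using out[of i] that prefix_order.trans by blast
  then show ?case
    using rstep_outside[OF step[of i]] succ assms(2) by (metis less_le_trans)
next
  case (limit l)
  have l: "l \<le> \<alpha>" using limit.hyps(2) assms(2) by simp
  have ctxt: "ctxt i r = T \<beta> r" if "\<beta> \<le> i" "i < l" "prefix r q" for i r
  proof -
    have "i < \<gamma>" using that(2) limit.hyps(2) by simp
    then have "\<not> prefix (ps i) r" using out[OF that(1)] that(3) prefix_order.trans by blast
    then show ?thesis using ctxt_outside limit.IH[OF that(1,2)] that(3) by simp
  qed
  have wf\<beta>: "wf_term ar (T \<beta>)" using wf assms(1,2) by simp
  have Some: "T l r = Some a" if "prefix r q" "T \<beta> r = Some a" "a \<noteq> Bot" for r a
  proof -
    have "stable_from ctxt \<beta> l r a"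
      unfolding stable_from_def
    proof (intro allI impI conjI)
      fix i
      assume i: "\<beta> \<le> i \<and> i < l"
      then show "ctxt i r = Some a" using ctxt[of i r] that by simp
      fix r'
      assume "prefix r' r"
      then have "prefix r' q" using that(1) prefix_order.trans by blast
      then show "ctxt i r' = ctxt \<beta> r'" using ctxt[of i r'] ctxt[of \<beta> r'] i limit.hyps(1) by simp
    qed
    then show ?thesis using liminf_Some_iff[OF l limit.hyps(3) that(3)] limit.hyps(1) by blast
  qed
  show ?case
  proof (intro allI impI)
    fix r
    assume r: "prefix r q"
    then have "T \<beta> r \<noteq> None" using assms(4) wf_term_prefix[OF wf\<beta>, of r] by (auto simp: prefix_def)
    then obtain a where a: "T \<beta> r = Some a" by auto
    show "T l r = T \<beta> r"
    proof (cases "a = Bot")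
      case True
      have "T l r \<noteq> None"
      proof (cases r rule: rev_cases)
        case Nil
        then show ?thesis using wf_term_Nil[OF wf[OF l]] by simp
      next
        case (snoc r' i)
        then obtain f where f: "T \<beta> r' = Some (Fun f)" "i < ar f"
          using a wf_term_child_iff[OF wf\<beta>, of r' i] by auto
        have "prefix r' q" using r snoc by (auto simp: prefix_def)
        then have "T l r' = Some (Fun f)" using Some f(1) by blast
        then show ?thesis using snoc f(2) wf_term_child_iff[OF wf[OF l], of r' i] by auto
      qed
      then obtain b where b: "T l r = Some b" by auto
      have "b = Bot"
      proof (rule ccontr)
        assume "b \<noteq> Bot"
        then obtain \<delta> where \<delta>: "\<delta> < l" "stable_from ctxt \<delta> l r b"
          using liminf_Some_iff[OF l limit.hyps(3)] b by blast
        have "max \<beta> \<delta> < l" using \<delta>(1) limit.hyps(1) by simp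
        then have "Some b = T \<beta> r"
          using stable_fromD[OF \<delta>(2), of "max \<beta> \<delta>"] ctxt[of "max \<beta> \<delta>" r] r by simp
        then show False using a True \<open>b \<noteq> Bot\<close> by simp
      qed
      then show ?thesis using a b True by simp
    next
      case False
      then show ?thesis using Some[OF r a] a by simp
    qed
  qed
qed simp

text \<open>Contractions at \<open>p\<close> itself are harmless: whether \<open>p\<close> exists is
  decided by its parent, which only a contraction at a strict prefix of \<open>p\<close> can
  touch.\<close>

lemma position_kept:
  assumes "\<beta> \<le> \<gamma>" "\<gamma> \<le> \<alpha>"
    and out: "\<And>i. \<beta> \<le> i \<Longrightarrow> i < \<gamma> \<Longrightarrow> \<not> strict_prefix (ps i) p"
    and p: "T \<beta> p \<noteq> None"
  shows "T \<gamma> p \<noteq> None"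
proof (cases p rule: rev_cases)
  case Nil
  then show ?thesis using wf_term_Nil[OF wf[OF assms(2)]] by simp
next
  case (snoc r i)
  have wf\<beta>: "wf_term ar (T \<beta>)" using wf assms(1,2) by simp
  obtain f where f: "T \<beta> r = Some (Fun f)" "i < ar f"
    using p snoc wf_term_child_iff[OF wf\<beta>, of r i] by auto
  have "\<not> prefix (ps j) r" if "\<beta> \<le> j" "j < \<gamma>" for j
    using out[OF that] snoc by (auto simp: strict_prefix_def prefix_def)
  then have "T \<gamma> r = T \<beta> r" using unchanged[OF assms(1,2)] f(1) by blast
  then show ?thesis using snoc f wf_term_child_iff[OF wf[OF assms(2)], of r i] by auto
qed

text \<open>If \<open>T\<close> is contracted at \<open>p\<close> cofinally below a limit, then the subterm at \<open>p\<close> is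
  root-active; otherwise its root is eventually constant and coinduction applies below it.\<close>

lemma conv_reduct:
  assumes "\<beta> \<le> \<gamma>" "\<gamma> \<le> \<alpha>"
    and "\<And>i. \<beta> \<le> i \<Longrightarrow> i < \<gamma> \<Longrightarrow> \<not> strict_prefix (ps i) p"
    and "T \<beta> p \<noteq> None" "conv s (subterm (T \<beta>) p)"
  shows "conv s (subterm (T \<gamma>) p)"
  using assms
\<comment> \<open>All of \<open>\<beta>\<close>, \<open>p\<close> and \<open>s\<close> vary, because
  the coinduction at a limit descends to arguments, restarts at later stages and replaces
  \<open>s\<close> by its reducts.\<close>
proof (induction \<gamma> arbitrary: \<beta> p s rule: less_induct)
  case (less \<gamma>)
  note IH = less.IH
  show ?case
  proof (cases "\<beta> = \<gamma>")
    case True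
    then show ?thesis using less.prems by simp
  next
    case False
    then have \<beta>: "\<beta> < \<gamma>" using less.prems(1) by simp
    show ?thesis
    proof (cases \<gamma> rule: ord_cases)
      case zero
      then show ?thesis using \<beta> ord_zero_le[of \<beta>] by simp
    next
      case (succ i)
      have "\<beta> < ord_succ i" using \<beta> succ(2) by simp
      then have i: "\<beta> \<le> i" "i < \<alpha>"
        using less_ord_succ_iff[OF succ(1)] less_le_trans[OF succ(1) less.prems(2)] by blast+
      have kept: "T i p \<noteq> None"
        using less.prems(3,4) succ(1) i by (intro position_kept[of \<beta> i p]) auto
      have s: "conv s (subterm (T i) p)"
        using less.prems(3-5) succ(1) i by (intro IH[of i \<beta> p s]) (auto simp del: subterm_app)
      show ?thesis
      proof (cases "prefix p (ps i)")
        case True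
        then obtain q where "ps i = p @ q" by (auto simp: prefix_def)
        then have "rstep R (subterm (T i) p) q (subterm (T \<gamma>) p)"
          using rstep_subterm step[OF i(2)] succ(2) by simp
        then show ?thesis using s conv_step by blast
      next
        case False
        have "\<not> prefix (ps i) p"
          using False less.prems(3)[OF i(1) succ(1)] by (auto simp: strict_prefix_def)
        then show ?thesis using s rstep_parallel[OF step[OF i(2)] _ False] succ(2) by (simp del: subterm_app)
      qed
    next
      case limit
      \<comment> \<open>Candidates are related at some stage \<open>\<beta>\<close> before the
        limit, from which on nothing is contracted strictly above \<open>p\<close>; the induction
        hypothesis carries this to every later stage below \<open>\<gamma>\<close>.\<close>
      define X where "X u v \<longleftrightarrow> (\<exists>\<beta> p. \<beta> < \<gamma> \<and> (\<forall>i. \<beta> \<le> i \<and> i < \<gamma> \<longrightarrow> \<not> strict_prefix (ps i) p) \<and>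
        T \<beta> p \<noteq> None \<and> conv u (subterm (T \<beta>) p) \<and> v = subterm (T \<gamma>) p)" for u v
      \<comment> \<open>The next contraction at \<open>p\<close> is lifted by
        \<open>conv_root_step\<close>. Its reduct is again related to the subterm at
        \<open>p\<close>, one stage later, and cofinality supplies another contraction.\<close>
      have active: "root_active u"
        if "\<beta> < \<gamma>" "\<forall>i. \<beta> \<le> i \<and> i < \<gamma> \<longrightarrow> \<not> strict_prefix (ps i) p" "T \<beta> p \<noteq> None"
          "conv u (subterm (T \<beta>) p)" "\<forall>\<delta><\<gamma>. \<exists>i. \<delta> \<le> i \<and> i < \<gamma> \<and> ps i = p" for u \<beta> p
      proof -
        note cofinal = that(5)
        have "\<exists>\<beta><\<gamma>. (\<forall>i. \<beta> \<le> i \<and> i < \<gamma> \<longrightarrow> \<not> strict_prefix (ps i) p) \<and> T \<beta> p \<noteq> None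
          \<and> conv u (subterm (T \<beta>) p)" using that by blast
        then show ?thesis
        proof (coinduction arbitrary: u rule: root_active.coinduct)
          case (root_active u)
          then obtain \<beta> where \<beta>: "\<beta> < \<gamma>" "\<forall>i. \<beta> \<le> i \<and> i < \<gamma> \<longrightarrow> \<not> strict_prefix (ps i) p"
            "T \<beta> p \<noteq> None" "conv u (subterm (T \<beta>) p)" by blast
          then obtain i where i: "\<beta> \<le> i" "i < \<gamma>" "ps i = p" using cofinal by blast
          have i\<alpha>: "i < \<alpha>" using i(2) less.prems(2) by simp
          have "conv u (subterm (T i) p)"
            using \<beta> i less.prems(2) by (intro IH[of i \<beta> p u]) (auto simp del: subterm_app)
          moreover have "rstep R (subterm (T i) p) [] (subterm (T (ord_succ i)) p)"
            using rstep_subterm[of R _ p "[]"] step[OF i\<alpha>] i(3) by simp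
          ultimately obtain qs v w where v: "fred R u qs v" "rstep R v [] w"
            "conv w (subterm (T (ord_succ i)) p)" by (rule conv_root_step)
          have succ: "ord_succ i < \<gamma>" using limit i(2) by (auto simp: is_limit_def)
          have "i < ord_succ i" using ord_succ_greater i(2) .
          then have "\<beta> \<le> ord_succ i" using i(1) by simp
          moreover have "T (ord_succ i) p \<noteq> None"
            using \<beta> succ less.prems(2) \<open>\<beta> \<le> ord_succ i\<close>
            by (intro position_kept[of \<beta> "ord_succ i" p]) auto
          ultimately have "\<exists>\<beta><\<gamma>. (\<forall>i. \<beta> \<le> i \<and> i < \<gamma> \<longrightarrow> \<not> strict_prefix (ps i) p) \<and> T \<beta> p \<noteq> None
            \<and> conv w (subterm (T \<beta>) p)"
            using succ \<beta>(2) v(3) by (meson order_trans)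
          then show ?case using v(1,2) by blast
        qed
      qed
      have "X u v \<Longrightarrow> conv u v" for u v
      proof (induction rule: conv_coinduct)
        case (1 u v)
        then obtain \<beta> p where \<beta>: "\<beta> < \<gamma>" "\<forall>i. \<beta> \<le> i \<and> i < \<gamma> \<longrightarrow> \<not> strict_prefix (ps i) p"
          "T \<beta> p \<noteq> None" "conv u (subterm (T \<beta>) p)" and v: "v = subterm (T \<gamma>) p"
          unfolding X_def by blast
        have kept: "T i p \<noteq> None" if "\<beta> \<le> i" "i \<le> \<gamma>" for i
          using \<beta> that less.prems(2) by (intro position_kept[of \<beta> i p]) auto
        have IH': "conv u (subterm (T i) p)" if "\<beta> \<le> i" "i < \<gamma>" for i
          using \<beta> that less.prems(2) by (intro IH[of i \<beta> p u]) (auto simp del: subterm_app)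
        have wfs: "wf_term ar u" "wf_term ar v"
          using conv_wf[OF \<beta>(4)] wf_subterm[OF wf[OF less.prems(2)] kept[of \<gamma>]] \<beta>(1) v by auto
        obtain a where a: "T \<gamma> p = Some a" using kept[OF order_less_imp_le[OF \<beta>(1)] order_refl] by auto
        show ?case
        proof (cases "a = Bot")
          case False
          \<comment> \<open>A proper label of the limit is stable in the contexts, so from some
            stage on no step contracts at or above \<open>p\<close>. The root exposed at stage
            \<open>\<epsilon>\<close> is final, and the arguments are candidates from
            \<open>\<epsilon>\<close> on.\<close>
          then obtain \<delta> where \<delta>: "\<delta> < \<gamma>" "stable_from ctxt \<delta> \<gamma> p a"
            using liminf_Some_iff[OF less.prems(2) limit] a by blast
          define \<epsilon> where "\<epsilon> = max \<beta> \<delta>"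
          have \<epsilon>: "\<beta> \<le> \<epsilon>" "\<delta> \<le> \<epsilon>" "\<epsilon> < \<gamma>" using \<beta>(1) \<delta>(1) by (auto simp: \<epsilon>_def)
          have out: "\<not> prefix (ps i) p" if "\<epsilon> \<le> i" "i < \<gamma>" for i
            using ctxt_Some(1)[OF stable_fromD[OF \<delta>(2)] False] that \<epsilon>(2) by simp
          have \<epsilon>p: "T \<epsilon> p = Some a"
            using ctxt_Some(2)[OF stable_fromD[OF \<delta>(2)] False] \<epsilon> by simp
          obtain qs w where w: "fred R u qs w" "w [] = Some a"
            "\<And>i. T \<epsilon> (p @ [i]) \<noteq> None \<Longrightarrow> conv (subterm w [i]) (subterm (T \<epsilon>) (p @ [i]))"
            using conv_ArgsE[OF IH'[OF \<epsilon>(1,3)]] \<epsilon>p False by auto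
          have "X (subterm w [i]) (subterm v [i])" if "v [i] \<noteq> None" for i
          proof -
            have wf\<epsilon>: "wf_term ar (T \<epsilon>)" using wf \<epsilon>(3) less.prems(2) by simp
            have "T \<epsilon> (p @ [i]) \<noteq> None"
              using that wf_term_child_iff[OF wf[OF less.prems(2)], of p i]
                wf_term_child_iff[OF wf\<epsilon>, of p i] v a \<epsilon>p by simp
            moreover have "\<not> strict_prefix (ps j) (p @ [i])" if "\<epsilon> \<le> j \<and> j < \<gamma>" for j
              using out[of j] that by (auto simp: strict_prefix_def)
            ultimately show ?thesis
              unfolding X_def using w(3) \<epsilon>(3) v by (intro exI[of _ \<epsilon>] exI[of _ "p @ [i]"]) auto
          qed
          moreover have "v [] = Some a" using a v by simp
          ultimately show ?thesis
            using wfs w(1,2) False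
            by (intro disjI2 conjI exI[of _ qs] exI[of _ w]) (simp_all del: subterm_app)
        next
          case True
          have v_bot: "v = bot_term" using wf_term_root_Bot[OF wfs(2)] v a True by simp
          show ?thesis
          proof (cases "\<forall>\<delta><\<gamma>. \<exists>i. \<delta> \<le> i \<and> i < \<gamma> \<and> ps i = p")
            case True
            then show ?thesis
              using active[OF \<beta>] conv.Root_active wfs(1) v_bot by blast
          next
            case False
            \<comment> \<open>With no contraction at \<open>p\<close> left, the \<open>Bot\<close>
              is not created by the limit: it is present at stage \<open>\<epsilon>\<close>, below
              \<open>\<gamma>\<close>, where the induction hypothesis applies.\<close>
            then obtain \<delta> where \<delta>: "\<delta> < \<gamma>" "\<And>i. \<delta> \<le> i \<Longrightarrow> i < \<gamma> \<Longrightarrow> ps i \<noteq> p" by blast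
            define \<epsilon> where "\<epsilon> = max \<beta> \<delta>"
            have \<epsilon>: "\<beta> \<le> \<epsilon>" "\<delta> \<le> \<epsilon>" "\<epsilon> < \<gamma>" using \<beta>(1) \<delta>(1) by (auto simp: \<epsilon>_def)
            have "\<not> prefix (ps i) p" if "\<epsilon> \<le> i" "i < \<gamma>" for i
              using \<delta>(2)[OF order_trans[OF \<epsilon>(2) that(1)] that(2)] \<beta>(2) order_trans[OF \<epsilon>(1) that(1)] that(2)
              by (auto simp: strict_prefix_def)
            then have "T \<gamma> p = T \<epsilon> p"
              using unchanged[of \<epsilon> \<gamma> p] \<epsilon> kept[of \<epsilon>] less.prems(2) by auto
            then have "subterm (T \<epsilon>) p = bot_term"
              using a \<open>a = Bot\<close> wf_term_root_Bot[OF wf_subterm[OF wf kept[OF \<epsilon>(1)]]] \<epsilon>(3) less.prems(2)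
              by simp
            then show ?thesis using IH'[OF \<epsilon>(1,3)] v_bot by simp
          qed
        qed
      qed
      moreover have "X s (subterm (T \<gamma>) p)"
        unfolding X_def using \<beta> less.prems(3-5) by blast
      ultimately show ?thesis by blast
    qed
  qed
qed

end

lemma is_liminf_cong:
  assumes "is_liminf ar c l t" "\<And>\<iota>. \<iota> < l \<Longrightarrow> c \<iota> = d \<iota>"
  shows "is_liminf ar d l t"
proof -
  have "{c \<iota> | \<iota>. \<beta> \<le> \<iota> \<and> \<iota> < l} = {d \<iota> | \<iota>. \<beta> \<le> \<iota> \<and> \<iota> < l}" for \<beta>
    using assms(2) by metis
  then show ?thesis using assms(1) unfolding is_liminf_def by simp
qed

lemma (in left_linear_TRS) strongly_p_converges_conv:
  fixes \<alpha> :: "'i::wellorder"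
  assumes "strongly_p_converges ar R s t \<alpha> ts ps"
  shows "conv s t"
proof -
  \<comment> \<open>For an open reduction \<open>ts \<alpha>\<close> is unconstrained, so the limit
    \<open>t\<close> takes its place; for a closed one this changes nothing.\<close>
  define T where "T i = (if i = \<alpha> then t else ts i)" for i
  have c: "ts ord_zero = s"
    "\<And>i. i < \<alpha> \<Longrightarrow> wf_term ar (ts i)" "\<And>i. i < \<alpha> \<Longrightarrow> rstep R (ts i) (ps i) (ts (ord_succ i))"
    "\<And>l. l < \<alpha> \<Longrightarrow> is_limit l \<Longrightarrow> is_liminf ar (\<lambda>i. replace (ts i) (ps i) bot_term) l (ts l)"
    "is_limit \<alpha> \<Longrightarrow> is_liminf ar (\<lambda>i. replace (ts i) (ps i) bot_term) \<alpha> t"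
    "\<not> is_limit \<alpha> \<Longrightarrow> wf_term ar t" "\<not> is_limit \<alpha> \<Longrightarrow> t = ts \<alpha>"
    using assms unfolding strongly_p_converges_def Let_def by (auto split: if_splits)
  have wft: "wf_term ar t" using c(5,6) is_liminf_wf by blast
  have T_less: "T i = ts i" if "i < \<alpha>" for i using that by (auto simp: T_def)
  interpret transfinite_reduction ar R \<alpha> T ps
  proof
    fix i
    assume "i \<le> \<alpha>"
    then show "wf_term ar (T i)"
      using c(2) wft by (cases "i = \<alpha>") (auto simp: T_def)
  next
    fix i
    assume i: "i < \<alpha>"
    have "T (ord_succ i) = ts (ord_succ i)"
    proof (cases "ord_succ i = \<alpha>")
      case True
      then have "\<not> is_limit \<alpha>" using i by (auto simp: is_limit_def)
      then show ?thesis using c(7) True by (simp add: T_def)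
    qed (simp add: T_def)
    then show "rstep R (T i) (ps i) (T (ord_succ i))" using c(3)[OF i] T_less[OF i] by simp
  next
    fix l
    assume l: "l \<le> \<alpha>" "is_limit l"
    have "is_liminf ar (\<lambda>i. replace (ts i) (ps i) bot_term) l (T l)"
      using c(4,5) l by (cases "l = \<alpha>") (auto simp: T_def)
    then show "is_liminf ar (\<lambda>i. replace (T i) (ps i) bot_term) l (T l)"
      by (rule is_liminf_cong) (use T_less l(1) in simp)
  qed
  have "T ord_zero = s"
    using c(1,7) by (cases "\<alpha> = ord_zero") (auto simp: T_def is_limit_def)
  moreover have "wf_term ar (T ord_zero)" by (rule wf[OF ord_zero_le])
  ultimately have "conv s (subterm (T \<alpha>) [])"
    using wf_term_Nil conv_refl by (intro conv_reduct[OF ord_zero_le order_refl]) auto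
  then show ?thesis by (simp add: T_def)
qed

section \<open>Reductions of length at most omega\<close>

lemma ord_zero_enat: "ord_zero = (0 :: enat)"
  using ord_zero_le[of "0 :: enat"] by simp

lemma ord_succ_enat: "ord_succ (enat i) = enat (Suc i)"
  unfolding ord_succ_def
proof (rule Least_equality)
  show "enat (Suc i) \<le> y" if "enat i < y" for y
    using that by (cases y) auto
qed simp

lemma not_is_limit_enat: "\<not> is_limit (enat i)"
proof (cases i)
  case 0
  then show ?thesis by (simp add: is_limit_def ord_zero_enat zero_enat_def)
next
  case (Suc j)
  then have "enat j < enat i" "\<not> ord_succ (enat j) < enat i" by (simp_all add: ord_succ_enat)
  then show ?thesis unfolding is_limit_def by blast
qed

lemma is_limit_infinity: "is_limit (\<infinity> :: enat)"
  unfolding is_limit_def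
proof (intro conjI allI impI)
  fix i :: enat
  assume "i < \<infinity>"
  then show "ord_succ i < \<infinity>" by (cases i) (auto simp: ord_succ_enat)
qed (simp add: ord_zero_enat)

lemma fred_sequence:
  "fred R s ps t \<Longrightarrow>
    \<exists>w. w 0 = s \<and> w (length ps) = t \<and> (\<forall>i<length ps. rstep R (w i) (ps ! i) (w (Suc i)))"
proof (induction rule: fred.induct)
  case (Nil s)
  then show ?case by auto
next
  case (Cons s p u ps t)
  then obtain w where w: "w 0 = u" "w (length ps) = t"
    "\<forall>i<length ps. rstep R (w i) (ps ! i) (w (Suc i))" by blast
  have "rstep R (case_nat s w i) ((p # ps) ! i) (case_nat s w (Suc i))" if "i < length (p # ps)" for i
    using that w Cons.hyps(1) by (cases i) auto
  then show ?case using w(2) by (intro exI[of _ "case_nat s w"]) auto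
qed

lemma strongly_p_converges_fred:
  assumes "fred R s ps t" "is_TRS ar R" "wf_term ar s"
  shows "\<exists>us qs. strongly_p_converges ar R s t (enat (length ps)) us qs"
proof -
  obtain w where w: "w 0 = s" "w (length ps) = t"
    "\<And>i. i < length ps \<Longrightarrow> rstep R (w i) (ps ! i) (w (Suc i))"
    using fred_sequence[OF assms(1)] by blast
  have wf: "i \<le> length ps \<Longrightarrow> wf_term ar (w i)" for i
  proof (induction i)
    case 0
    then show ?case using w(1) assms(3) by simp
  next
    case (Suc i)
    then show ?case using rstep_wf[OF assms(2) _ w(3)[of i]] by simp
  qed
  have "strongly_p_converges ar R s t (enat (length ps)) (\<lambda>x. w (the_enat x)) (\<lambda>x. ps ! the_enat x)"
    unfolding strongly_p_converges_def Let_def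
  proof (intro conjI allI impI)
    show "w (the_enat ord_zero) = s" using w(1) by (simp add: ord_zero_enat zero_enat_def)
  next
    fix x
    assume "x < enat (length ps)"
    then obtain i where "x = enat i" "i < length ps" by (cases x) auto
    then show "wf_term ar (w (the_enat x))"
      "rstep R (w (the_enat x)) (ps ! the_enat x) (w (the_enat (ord_succ x)))"
      using wf[of i] w(3)[of i] by (simp_all add: ord_succ_enat)
  next
    fix x
    assume "x < enat (length ps)" "is_limit x"
    then show "is_liminf ar (\<lambda>i. replace (w (the_enat i)) (ps ! the_enat i) bot_term) x (w (the_enat x))"
      using not_is_limit_enat by (cases x) auto
  next
    show "if is_limit (enat (length ps))
      then is_liminf ar (\<lambda>i. replace (w (the_enat i)) (ps ! the_enat i) bot_term) (enat (length ps)) t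
      else wf_term ar t \<and> t = w (the_enat (enat (length ps)))"
      using wf[of "length ps"] w(2) not_is_limit_enat by simp
  qed
  then show ?thesis by blast
qed

text \<open>\<open>N i\<close> is the round that step \<open>i\<close> belongs to. Block
  \<open>n\<close> starts at some \<open>i \<ge> n\<close> and all its positions are contracted from
  there on; this turns a visit in every late round into cofinally many visits.\<close>

lemma fred_concat:
  assumes fred: "\<And>n. fred R (u n) (ps n) (u (Suc n))" and ne: "\<And>n. ps n \<noteq> []"
  obtains w q N where "w 0 = u 0" "\<And>i. rstep R (w i) (q i) (w (Suc i))"
    "\<And>i. q i \<in> set (ps (N i))" "mono N"
    "\<And>n. \<exists>i\<ge>n. w i = u n \<and> N i = n \<and> (\<forall>p\<in>set (ps n). \<exists>j\<ge>i. q j = p)"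
proof -
  from fred_sequence[OF fred]
  obtain W where W: "\<And>n. W n 0 = u n" "\<And>n. W n (length (ps n)) = u (Suc n)"
    "\<And>n i. i < length (ps n) \<Longrightarrow> rstep R (W n i) (ps n ! i) (W n (Suc i))"
    by metis
  \<comment> \<open>Step \<open>i\<close> is step \<open>snd (idx i)\<close> of round
    \<open>fst (idx i)\<close>. The offset returns to 0 when a round is used up, which is sound
    because the next round is nonempty.\<close>
  define idx where "idx = rec_nat (0, 0)
    (\<lambda>_ (n, j). if Suc j < length (ps n) then (n, Suc j) else (Suc n, 0))"
  define w where "w i = W (fst (idx i)) (snd (idx i))" for i
  define q where "q i = ps (fst (idx i)) ! snd (idx i)" for i
  have idx_0: "idx 0 = (0, 0)" by (simp add: idx_def)
  have idx_Suc: "idx (Suc i) = (if Suc (snd (idx i)) < length (ps (fst (idx i)))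
    then (fst (idx i), Suc (snd (idx i))) else (Suc (fst (idx i)), 0))" for i
    by (simp add: idx_def split: prod.split)
  have less: "snd (idx i) < length (ps (fst (idx i)))" for i
    by (cases i) (use ne in \<open>auto simp: idx_0 idx_Suc\<close>)
  have rstep: "rstep R (w i) (q i) (w (Suc i))" for i
  proof (cases "Suc (snd (idx i)) < length (ps (fst (idx i)))")
    case True
    then show ?thesis using W(3)[OF less[of i]] by (simp add: w_def q_def idx_Suc)
  next
    case False
    then have "Suc (snd (idx i)) = length (ps (fst (idx i)))" using less[of i] by simp
    then have "w (Suc i) = W (fst (idx i)) (Suc (snd (idx i)))"
      using W(1,2) by (simp add: w_def idx_Suc)
    then show ?thesis using W(3)[OF less[of i]] by (simp add: w_def q_def)
  qed
  have block: "idx (i + j) = (n, j)" if "idx i = (n, 0)" "j < length (ps n)" for i j n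
    using that(2)
  proof (induction j)
    case 0
    then show ?case using that(1) by simp
  next
    case (Suc j)
    then show ?case by (simp add: idx_Suc)
  qed
  have start: "\<exists>i. idx i = (n, 0)" for n
  proof (induction n)
    case 0
    then show ?case using idx_0 by blast
  next
    case (Suc n)
    then obtain i where i: "idx i = (n, 0)" ..
    have "length (ps n) - 1 < length (ps n)" using ne[of n] by simp
    from block[OF i this] have "idx (Suc (i + (length (ps n) - 1))) = (Suc n, 0)"
      by (simp add: idx_Suc)
    then show ?case ..
  qed
  have le: "fst (idx i) \<le> i" for i
    by (induction i) (auto simp: idx_0 idx_Suc)
  show thesis
  proof (rule that[of w q "\<lambda>i. fst (idx i)"])
    show "w 0 = u 0" using W(1) by (simp add: w_def idx_0)
    show "rstep R (w i) (q i) (w (Suc i))" for i by (rule rstep)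
    show "q i \<in> set (ps (fst (idx i)))" for i using less[of i] by (simp add: q_def)
    show "mono (\<lambda>i. fst (idx i))" by (rule mono_iff_le_Suc[THEN iffD2]) (auto simp: idx_Suc)
    fix n
    obtain i where i: "idx i = (n, 0)" using start ..
    have "\<exists>j\<ge>i. q j = p" if "p \<in> set (ps n)" for p
    proof -
      obtain k where "k < length (ps n)" "ps n ! k = p" using \<open>p \<in> set (ps n)\<close> by (auto simp: in_set_conv_nth)
      then have "q (i + k) = p" using block[OF i] by (simp add: q_def)
      then show ?thesis using le_add1 by blast
    qed
    then show "\<exists>i\<ge>n. w i = u n \<and> fst (idx i) = n \<and> (\<forall>p\<in>set (ps n). \<exists>j\<ge>i. q j = p)"
      using i le[of i] W(1) by (intro exI[of _ i]) (auto simp: w_def)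
  qed
qed

section \<open>Fair reductions\<close>

context left_linear_TRS
begin

text \<open>Progress to finite depth: proper labels of \<open>t\<close> on the first
  \<open>n\<close> levels are in place, and at the frontier only \<open>conv\<close> is known. A
  bottom within these levels is already settled as present or as root-active, hence to be contracted
  for ever.\<close>

primrec approx :: "nat \<Rightarrow> ('f, 'v) pterm \<Rightarrow> ('f, 'v) pterm \<Rightarrow> bool" where
  "approx 0 u t \<longleftrightarrow> conv u t"
| "approx (Suc n) u t \<longleftrightarrow>
    (if t [] = Some Bot then u = bot_term \<or> root_active u
     else u [] = t [] \<and> (\<forall>i. t [i] \<noteq> None \<longrightarrow> approx n (subterm u [i]) (subterm t [i])))"

lemma approx_Some:
  assumes "approx n u t" "wf_term ar t" "length p < n" "t p = Some a" "a \<noteq> Bot"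
  shows "u p = Some a"
  using assms
proof (induction n arbitrary: u t p)
  case (Suc n)
  show ?case
  proof (cases p)
    case Nil
    then show ?thesis using Suc.prems by (auto split: if_splits)
  next
    case (Cons i q)
    then have "t ([i] @ q) \<noteq> None" using Suc.prems(4) by simp
    then have ti: "t [i] \<noteq> None" by (rule wf_term_prefix[OF Suc.prems(2)])
    then have "t [] \<noteq> Some Bot" using wf_term_Fun[OF Suc.prems(2), of "[]" "[i]"] by auto
    then have "approx n (subterm u [i]) (subterm t [i])" using Suc.prems(1) ti by (simp del: subterm_app)
    from Suc.IH[OF this wf_subterm[OF Suc.prems(2) ti], of q] show ?thesis
      using Suc.prems Cons by simp
  qed
qed simp

text \<open>One round of the fair strategy: expose the next level of the target and, at each
  root-active position above that level, contract once more.\<close>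

definition fair_round ::
  "('f, 'v) pterm \<Rightarrow> nat \<Rightarrow> ('f, 'v) pterm \<Rightarrow> nat \<Rightarrow> pos list \<Rightarrow> ('f, 'v) pterm \<Rightarrow> bool" where
  "fair_round t n u m ps v \<longleftrightarrow> fred R u ps v \<and> approx m v t \<and>
    (\<forall>p\<in>set ps. \<forall>q a. prefix p q \<and> t q = Some a \<and> a \<noteq> Bot \<longrightarrow> n \<le> length q) \<and>
    (\<forall>p. t p = Some Bot \<and> length p < n \<longrightarrow> p \<in> set ps \<or> v p = Some Bot)"

lemma fair_round_mono:
  "fair_round t n u m ps v \<Longrightarrow> n' \<le> n \<Longrightarrow> fair_round t n' u m ps v"
  unfolding fair_round_def by (meson order_trans order_less_le_trans)

lemma fair_round_exists:
  assumes "approx n u t" "wf_term ar u" "wf_term ar t"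
  shows "\<exists>ps v. fair_round t n u (Suc n) ps v"
  using assms
proof (induction n arbitrary: u t)
  case 0
  then have "conv u t" by simp
  then show ?case
  proof cases
    case (Bot ps)
    then show ?thesis by (intro exI[of _ ps] exI[of _ bot_term]) (simp add: fair_round_def)
  next
    case Root_active
    then show ?thesis by (intro exI[of _ "[]"] exI[of _ u]) (simp add: fair_round_def)
  next
    case (Args ps v)
    then show ?thesis
      by (intro exI[of _ ps] exI[of _ v]) (simp add: fair_round_def del: subterm_app)
  qed
next
  case (Suc n)
  note wf = Suc.prems(2,3)
  show ?case
  proof (cases "t [] = Some Bot")
    case True
    then have t: "t = bot_term" using wf_term_root_Bot[OF wf(2)] by simp
    have only_root: "t q = Some a \<longleftrightarrow> q = [] \<and> a = Bot" for q a
      unfolding t by (auto simp: bot_term_def)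
    from Suc.prems(1) True consider "u = bot_term" | "root_active u" by auto
    then show ?thesis
    proof cases
      case 1
      then show ?thesis
        using True by (intro exI[of _ "[]"] exI[of _ u]) (auto simp: fair_round_def only_root)
    next
      case 2
      \<comment> \<open>One root contraction per round is enough, since the contractum is
        root-active again and the approximation survives.\<close>
      then obtain ps v w where "fred R u ps v" "rstep R v [] w" "root_active w"
        by (cases rule: root_active.cases) blast
      then show ?thesis
        using True fred_snoc[of R u ps v "[]" w]
        by (intro exI[of _ "ps @ [[]]"] exI[of _ w]) (auto simp: fair_round_def only_root)
    qed
  next
    case False
    then have root: "u [] = t []"
      and args: "\<And>i. t [i] \<noteq> None \<Longrightarrow> approx n (subterm u [i]) (subterm t [i])"
      using Suc.prems(1) by (simp_all del: subterm_app)
    have child: "u [i] \<noteq> None \<longleftrightarrow> t [i] \<noteq> None" for i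
      using wf_term_child_iff[OF wf(1), of "[]" i] wf_term_child_iff[OF wf(2), of "[]" i] root by simp
    have "\<exists>ps v. fair_round (subterm t [i]) n (subterm u [i]) (Suc n) ps v" if "t [i] \<noteq> None" for i
      using Suc.IH[OF args[OF that]] wf_subterm[OF wf(1)] wf_subterm[OF wf(2) that] child that by blast
    then obtain ps v where pv:
      "\<And>i. t [i] \<noteq> None \<Longrightarrow> fair_round (subterm t [i]) n (subterm u [i]) (Suc n) (ps i) (v i)"
      by metis
    have "fred R (subterm u [i]) (ps i) (v i)" if "u [i] \<noteq> None" for i
      using pv[of i] that child unfolding fair_round_def by blast
    from fred_args[OF wf(1) this]
    obtain qs w where w: "fred R u qs w" "w [] = u []" "\<And>i. u [i] \<noteq> None \<Longrightarrow> subterm w [i] = v i"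
      "set qs = (\<Union>i\<in>{i. u [i] \<noteq> None}. (#) i ` set (ps i))" by blast
    have "approx (Suc (Suc n)) w t"
    proof -
      have "approx (Suc n) (subterm w [i]) (subterm t [i])" if "t [i] \<noteq> None" for i
        using pv[OF that] w(3)[of i] child that unfolding fair_round_def by metis
      then show ?thesis using False root w(2) by (simp del: approx.simps add: approx.simps(2)[of "Suc n"])
    qed
    moreover have "Suc n \<le> length q"
      if p: "p \<in> set qs" and q: "prefix p q" "t q = Some a" "a \<noteq> Bot" for p q a
    proof -
      obtain i p' where i: "p = i # p'" "p' \<in> set (ps i)" "u [i] \<noteq> None" using p w(4) by auto
      then obtain q' where q': "q = i # q'" "prefix p' q'" using q(1) by (cases q) auto
      have "subterm t [i] q' = Some a" using q(2) q'(1) by simp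
      then have "n \<le> length q'"
        using pv[of i] i(2,3) child q'(2) q(3) unfolding fair_round_def by blast
      then show ?thesis using q'(1) by simp
    qed
    moreover have "p \<in> set qs \<or> w p = Some Bot" if p: "t p = Some Bot" "length p < Suc n" for p
    proof -
      obtain i p' where i: "p = i # p'" using p(1) False by (cases p) auto
      then have "t ([i] @ p') \<noteq> None" using p(1) by simp
      then have ti: "t [i] \<noteq> None" by (rule wf_term_prefix[OF wf(2)])
      have "subterm t [i] p' = Some Bot" using p(1) i by simp
      then have "p' \<in> set (ps i) \<or> v i p' = Some Bot"
        using pv[OF ti] p(2) i unfolding fair_round_def by auto
      then show ?thesis
      proof
        assume "p' \<in> set (ps i)"
        then have "i # p' \<in> set qs" using child ti unfolding w(4) by auto
        then show ?thesis using i by simp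
      next
        assume "v i p' = Some Bot"
        then have "subterm w [i] p' = Some Bot" using w(3)[of i] child ti by (simp del: subterm_app)
        then show ?thesis using i by simp
      qed
    qed
    ultimately show ?thesis using w(1) unfolding fair_round_def by blast
  qed
qed

text \<open>The target level \<open>m\<close> of a round is independent of \<open>n\<close>, so
  levels that cost no contraction can be skipped. If every target only admits empty rounds,
  weakening by \<open>fair_round_mono\<close> makes the rounds at all deeper levels empty too. Then
  \<open>u\<close> itself approximates \<open>t\<close> to every depth, and an empty round that must
  visit each bottom of \<open>t\<close> finds \<open>Bot\<close> in \<open>u\<close>.\<close>

lemma stuck_round_finished:
  assumes "approx n u t" "wf_term ar u" "wf_term ar t"
    and stuck: "\<And>m ps v. n < m \<Longrightarrow> fair_round t n u m ps v \<Longrightarrow> ps = []"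
  shows "u = t"
proof -
  have round: "fair_round t (n + k) u (Suc (n + k)) [] u" if "approx (n + k) u t" for k
  proof -
    obtain ps v where r: "fair_round t (n + k) u (Suc (n + k)) ps v"
      using fair_round_exists[OF \<open>approx (n + k) u t\<close> assms(2,3)] by blast
    have "ps = []" by (rule stuck[OF _ fair_round_mono[OF r]]) simp_all
    moreover from this have "u = v" using r by (simp add: fair_round_def)
    ultimately show ?thesis using r by simp
  qed
  have approx: "approx (n + k) u t" for k
  proof (induction k)
    case 0
    then show ?case using assms(1) by simp
  next
    case (Suc k)
    from round[OF this] show ?case by (simp del: approx.simps add: fair_round_def)
  qed
  show ?thesis
  proof (rule wf_term_eqI[OF assms(2,3)])
    fix p a
    assume p: "t p = Some a"
    have len: "length p < n + Suc (length p)" by simp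
    show "u p = Some a"
    proof (cases "a = Bot")
      case True
      then show ?thesis using round[OF approx, of "Suc (length p)"] p len unfolding fair_round_def by auto
    next
      case False
      then show ?thesis using approx_Some[OF approx assms(3) len p] by simp
    qed
  qed
qed

lemma strongly_p_converges_fair:
  assumes t: "wf_term ar t" and wf0: "wf_term ar (u 0)"
    and round: "\<And>n. fair_round t (m n) (u n) (m (Suc n)) (ps n) (u (Suc n))"
    and init: "approx (m 0) (u 0) t"
    and ne: "\<And>n. ps n \<noteq> []" and m: "\<And>n. n \<le> m n"
  shows "\<exists>us qs. strongly_p_converges ar R (u 0) t (\<infinity> :: enat) us qs"
proof -
  have fred: "fred R (u n) (ps n) (u (Suc n))" for n
    using round[of n] by (simp add: fair_round_def)
  have approx: "approx (m n) (u n) t" for n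
    by (cases n) (use init round in \<open>auto simp: fair_round_def\<close>)
  \<comment> \<open>Depth is measured at the proper labels of \<open>t\<close> at or below the
    contracted position, not at that position: root-active positions stay shallow, but
    \<open>t\<close> has only bottom there.\<close>
  have deep: "m n \<le> length q" if "p \<in> set (ps n)" "prefix p q" "t q = Some a" "a \<noteq> Bot" for n p q a
    using round[of n] that unfolding fair_round_def by blast
  have visit: "p \<in> set (ps n) \<or> u (Suc n) p = Some Bot" if "t p = Some Bot" "length p < m n" for n p
    using round[of n] that unfolding fair_round_def by blast
  obtain w q N where w: "w 0 = u 0" "\<And>i. rstep R (w i) (q i) (w (Suc i))"
    "\<And>i. q i \<in> set (ps (N i))" "mono N"
    "\<And>n. \<exists>i\<ge>n. w i = u n \<and> N i = n \<and> (\<forall>p\<in>set (ps n). \<exists>j\<ge>i. q j = p)"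
    using fred_concat[of R u ps, OF fred ne] by blast
  have wf: "wf_term ar (w i)" for i
    by (induction i) (use w(1) wf0 rstep_wf[OF TRS _ w(2)] in auto)
  define c where "c i = replace (w (the_enat i)) (q (the_enat i)) bot_term" for i
  have "is_liminf ar c \<infinity> t"
  proof (rule is_liminfI)
    fix i :: enat
    assume "i < \<infinity>"
    show "wf_term ar (c i)"
      unfolding c_def using wf rstep_at[OF w(2)] by (intro wf_replace) auto
  next
    fix p a
    assume p: "t p = Some a" "a \<noteq> Bot"
    \<comment> \<open>As \<open>n \<le> m n\<close>, from this round on every contraction spares
      proper labels at depth \<open>length p\<close>, so the path to \<open>p\<close> is
      frozen.\<close>
    let ?n = "Suc (length p)"
    obtain i where i: "w i = u ?n" "N i = ?n" using w(5)[of ?n] by blast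
    have out: "\<not> prefix (q j) p" if "i \<le> j" for j
    proof
      assume "prefix (q j) p"
      from deep[OF w(3) this p] have "m (N j) \<le> length p" .
      moreover have "?n \<le> N j" using monoD[OF w(4) that] i(2) by simp
      ultimately show False using m[of "N j"] by simp
    qed
    have w_eq: "w j r = t r" if "i \<le> j" "prefix r p" for j r
      using that(1)
    proof (induction j rule: dec_induct)
      case base
      have "\<exists>b. t r = Some b \<and> b \<noteq> Bot"
        using p that(2) wf_term_strict_prefix[OF t, of p r] by (cases "r = p") (auto simp: strict_prefix_def)
      then obtain b where b: "t r = Some b" "b \<noteq> Bot" by blast
      have "length r < m ?n" using prefix_length_le[OF that(2)] m[of ?n] by simp
      then show ?case using approx_Some[OF approx t _ b] i(1) b(1) by simp
    next
      case (step j)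
      have "\<not> prefix (q j) r" using out[OF step.hyps(1)] that(2) prefix_order.trans by blast
      then show ?case using rstep_outside[OF w(2)] step.IH by simp
    qed
    have c_eq: "c (enat j) r = t r" if "i \<le> j" "prefix r p" for j r
    proof -
      have "\<not> prefix (q j) r" using out[OF that(1)] that(2) prefix_order.trans by blast
      then show ?thesis using w_eq[OF that] by (simp add: c_def replace_outside)
    qed
    have "stable_from c (enat i) \<infinity> p a"
      unfolding stable_from_def
    proof (intro allI impI)
      fix x
      assume "enat i \<le> x \<and> x < \<infinity>"
      then obtain j where "x = enat j" "i \<le> j" by (cases x) auto
      then show "c x p = Some a \<and> (\<forall>r. prefix r p \<longrightarrow> c x r = c (enat i) r)"
        using c_eq p(1) by simp
    qed
    then show "\<exists>\<beta><\<infinity>. stable_from c \<beta> \<infinity> p a" by (intro exI[of _ "enat i"]) simp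
  next
    fix p and \<beta> :: enat
    assume p: "t p = Some Bot" and "\<beta> < \<infinity>"
    then obtain b where b: "\<beta> = enat b" by (cases \<beta>) auto
    \<comment> \<open>Late enough to lie beyond \<open>b\<close> and to have \<open>p\<close> above
      the current level, so that the round contracts at \<open>p\<close> or ends with
      \<open>Bot\<close> there.\<close>
    let ?n = "max b (Suc (length p))"
    have "length p < m ?n" using m[of ?n] by simp
    then consider "p \<in> set (ps ?n)" | "u (Suc ?n) p = Some Bot" using visit p by blast
    then have "\<exists>j\<ge>b. c (enat j) p = None \<or> c (enat j) p = Some Bot"
    proof cases
      case 1
      moreover obtain i where "?n \<le> i" "\<forall>p\<in>set (ps ?n). \<exists>j\<ge>i. q j = p" using w(5)[of ?n] by blast
      ultimately obtain j where "i \<le> j" "q j = p" by blast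
      then have "b \<le> j" using \<open>?n \<le> i\<close> by simp
      then show ?thesis using \<open>q j = p\<close> by (intro exI[of _ j]) (simp add: c_def)
    next
      case 2
      obtain j where j: "Suc ?n \<le> j" "w j = u (Suc ?n)" using w(5)[of "Suc ?n"] by blast
      have "c (enat j) p = None \<or> c (enat j) p = Some Bot"
      \<comment> \<open>The next step may already strike at or above \<open>p\<close>, but then the
        context has \<open>Bot\<close> or nothing at \<open>p\<close>.\<close>
      proof (cases "prefix (q j) p")
        case True
        then show ?thesis by (auto simp: c_def prefix_def bot_term_def)
      next
        case False
        then show ?thesis using 2 j(2) by (simp add: c_def replace_outside)
      qed
      then show ?thesis using j(1) by (intro exI[of _ j]) auto
    qed
    then obtain j where "b \<le> j" "c (enat j) p = None \<or> c (enat j) p = Some Bot" by blast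
    then show "\<exists>\<iota>. \<beta> \<le> \<iota> \<and> \<iota> < \<infinity> \<and> (c \<iota> p = None \<or> c \<iota> p = Some Bot)"
      unfolding b by (intro exI[of _ "enat j"]) simp
  qed (rule t)
  then have "strongly_p_converges ar R (u 0) t \<infinity> (\<lambda>x. w (the_enat x)) (\<lambda>x. q (the_enat x))"
    unfolding strongly_p_converges_def Let_def
  proof (intro conjI allI impI)
    show "w (the_enat ord_zero) = u 0" using w(1) by (simp add: ord_zero_enat zero_enat_def)
  next
    fix x :: enat
    assume "x < \<infinity>"
    then obtain i where x: "x = enat i" by (cases x) auto
    show "wf_term ar (w (the_enat x))" using wf .
    show "rstep R (w (the_enat x)) (q (the_enat x)) (w (the_enat (ord_succ x)))"
      unfolding x ord_succ_enat using w(2) by simp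
  next
    fix x :: enat
    assume "x < \<infinity>" "is_limit x"
    then show "is_liminf ar (\<lambda>i. replace (w (the_enat i)) (q (the_enat i)) bot_term) x (w (the_enat x))"
      using not_is_limit_enat by (cases x) auto
  next
    assume "is_liminf ar c \<infinity> t"
    then show "if is_limit (\<infinity> :: enat)
      then is_liminf ar (\<lambda>i. replace (w (the_enat i)) (q (the_enat i)) bot_term) \<infinity> t
      else wf_term ar t \<and> t = w (the_enat \<infinity>)"
      using is_limit_infinity by (simp add: c_def[abs_def])
  qed
  then show ?thesis by blast
qed

lemma conv_strongly_p_converges:
  assumes "conv s t"
  shows "\<exists>(\<beta>::enat) us qs. strongly_p_converges ar R s t \<beta> us qs"
proof -
  have wf: "wf_term ar s" "wf_term ar t" using conv_wf[OF assms] by auto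
  define P where "P x \<longleftrightarrow> (\<exists>ps. fred R s ps (snd x)) \<and> approx (fst x) (snd x) t" for x
  \<comment> \<open>Strictly growing levels put round \<open>n\<close> at level \<open>n\<close> or
    deeper; nonempty rounds make the concatenation infinite.\<close>
  define Q where "Q x y ps \<longleftrightarrow> fst x < fst y \<and> ps \<noteq> [] \<and> fair_round t (fst x) (snd x) (fst y) ps (snd y)"
    for x y ps
  show ?thesis
  \<comment> \<open>This alternative decides the length: omega if a round with a contraction is
    always available, and finite otherwise, because a term without such a round is already
    \<open>t\<close>.\<close>
  proof (cases "\<forall>x. P x \<longrightarrow> (\<exists>y ps. Q x y ps)")
    case True
    have start: "P (0, s)" using assms by (auto simp: P_def intro: fred.Nil)
    have "\<exists>y. P y \<and> (\<exists>ps. Q x y ps)" if x: "P x" for x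
    proof -
      obtain y ps where y: "Q x y ps" using True x by blast
      then have "P y"
        using x fred_append unfolding P_def Q_def fair_round_def by blast
      then show ?thesis using y by blast
    qed
    \<comment> \<open>The conjunct for \<open>n = 0\<close> fixes the starting point, which
      dependent choice would otherwise leave open.\<close>
    then have "\<exists>f. \<forall>n. (P (f n) \<and> (n = 0 \<longrightarrow> f n = (0, s))) \<and> (\<exists>ps. Q (f n) (f (Suc n)) ps)"
      using start
      by (intro dependent_nat_choice[of "\<lambda>n x. P x \<and> (n = 0 \<longrightarrow> x = (0, s))" "\<lambda>_ x y. \<exists>ps. Q x y ps"])
        auto
    then obtain f where f: "f 0 = (0, s)" "\<And>n. \<exists>ps. Q (f n) (f (Suc n)) ps" by blast
    then obtain ps where ps: "\<And>n. Q (f n) (f (Suc n)) (ps n)" by metis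
    have "n \<le> fst (f n)" for n
    proof (induction n)
      case (Suc n)
      then show ?case using ps[of n] by (simp add: Q_def)
    qed simp
    then have "\<exists>us qs. strongly_p_converges ar R (snd (f 0)) t (\<infinity> :: enat) us qs"
      using ps f(1) wf assms
      by (intro strongly_p_converges_fair[where m = "\<lambda>n. fst (f n)" and ps = ps]) (auto simp: Q_def)
    then show ?thesis using f(1) by auto
  next
    case False
    then obtain n u ps where u: "fred R s ps u" "approx n u t" "\<And>y ps. \<not> Q (n, u) y ps"
      unfolding P_def by auto
    have "u = t"
    proof (rule stuck_round_finished[OF u(2) fred_wf[OF u(1) TRS wf(1)] wf(2)])
      fix m qs v
      assume "n < m" "fair_round t n u m qs v"
      then show "qs = []" using u(3)[of "(m, v)" qs] by (simp add: Q_def)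
    qed
    then show ?thesis using strongly_p_converges_fred[OF _ TRS wf(1)] u(1) by blast
  qed
qed

end

theorem theorem6p15:
  fixes ar :: "'f \<Rightarrow> nat"
    and R :: "('f, 'v) rule set"
    and s t :: "('f, 'v) pterm"
    and \<alpha> :: "'i::wellorder"
    and ts :: "'i \<Rightarrow> ('f, 'v) pterm"
    and ps :: "'i \<Rightarrow> pos"
  assumes "is_TRS ar R"
    and "orthogonal ar R"
    and "left_finite R"
    and "strongly_p_converges ar R s t \<alpha> ts ps"
  shows "\<exists>(\<beta>::enat) us qs. strongly_p_converges ar R s t \<beta> us qs"
proof -
  interpret left_linear_TRS ar R
    using assms(1-3) by unfold_locales (simp_all add: orthogonal_def)
  show ?thesis
    using conv_strongly_p_converges[OF strongly_p_converges_conv[OF assms(4)]] .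
qed

end
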